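(* Let $k$ be a field of characteristic zero. For the 2-cycles conjugacy class $\mathcal{C}$ on $S_N$, the flat connections with constant coefficients in $\{0,1\}$ of submaximal cardinality (i.e. those in the stratum immediately below the one of top cardinality $|\mathcal{C}|$) are precisely the $$\alpha_i=-\theta_i,\qquad\theta_i=\sum_{j\neq i}e_{(ij)},\qquad i=1,\dots,N.$$ The associated module $V_n=kF_n/k\theta$, where $F_n$ is the submaximal stratum, is the fundamental representation of $S_N$, i.e. the standard $(N-1)$-dimensional representation.
   Context: Let $G=S_N$ and $\mathcal{C}$ its conjugacy class of 2-cycles $(ij)=(ji)$, $i\ne j$ in $\{1,\dots,N\}$. Let $\Lambda^1=k\mathcal{C}$ with basis $\{e_a\}_{a\in\mathcal{C}}$, with braiding $\Psi(e_a\otimes e_b)=e_{aba^{-1}}\otimes e_a$, let $\Lambda_{quad}=T\Lambda^1/\langle\ker(\mathrm{id}-\Psi)\rangle$ be the quadratic algebra of invariant differential forms, where the kernel is taken in $\Lambda^1\otimes\Lambda^1$, and let $\theta=\sum_{a\in\mathcal{C}}e_a$. The exterior derivative satisfies $\mathrm{d}e_a=\theta e_a+e_a\theta$. A connection with constant coefficients is an element $\alpha\in\Lambda^1$; its curvature is $F(\alpha)=\mathrm{d}\alpha+\alpha^2$, and it is flat if $F(\alpha)=0$. Write $\phi=\alpha+\theta=\sum_a\phi^ae_a$ with $\phi^a\in k$; one has $F(\alpha)=\phi^2$. "Coefficients in $\{0,1\}$" means $\phi^a\in\{0,1\}$ for all $a$. The cardinality of $\alpha$ is the number of $a\in\mathcal{C}$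 with $\phi^a\ne0$, and the stratum $F_n$ is the set of flat connections with constant coefficients in $\{0,1\}$, represented by their $\phi$, of cardinality $n$. The stratum of top cardinality $|\mathcal{C}|$ has the single point $\phi=\theta$ (that is, $\alpha=0$). $G$ acts on $\Lambda^1$ by $g\cdot e_a=e_{gag^{-1}}$; each $F_n$ is stable under this action, and $kF_n\subseteq\Lambda^1$ denotes the span of $F_n$. Typically $\theta\in kF_n$, and the module associated to the stratum is $V_n=kF_n/k\theta$.
   Formalization: The classification is stated for N ≥ 2 (for N = 1 there is no submaximal stratum) and the module claim for N ≥ 3: for N = 2 the submaximal stratum is φ = 0, so kF_n = 0 does not contain θ and kF_n/kθ is not the 1-dimensional standard representation. *)

theory Defs
  imports
    "HOL-Library.Poly_Mapping"
    "HOL-Algebra.Sym_Groups"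
    "HOL-Algebra.QuotRing"
    "HOL-Algebra.Module"
    "HOL-Algebra.Algebraic_Closure_Type"
begin

section \<open>Vector spaces with a given basis\<close>

text \<open>
  The vector space with basis a set of keys is rendered as finitely supported functions
  on the type of keys.
\<close>

definition pscale :: "'k::field \<Rightarrow> ('a \<Rightarrow>\<^sub>0 'k) \<Rightarrow> ('a \<Rightarrow>\<^sub>0 'k)" where
  "pscale c p = Poly_Mapping.map ((*) c) p"

lemma lookup_pscale [simp]:
  "Poly_Mapping.lookup (pscale c p) x = c * Poly_Mapping.lookup p x"
  unfolding pscale_def by transfer (simp add: when_def)

interpretation pm: vector_space "pscale :: 'k::field \<Rightarrow> ('a \<Rightarrow>\<^sub>0 'k) \<Rightarrow> ('a \<Rightarrow>\<^sub>0 'k)"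
  by unfold_locales (auto intro!: poly_mapping_eqI simp: lookup_add algebra_simps)

text \<open>
  Lists under concatenation are the free monoid, so the convolution product of
  finitely supported functions on lists is the multiplication of the tensor algebra:
  the word \<open>[a, b]\<close> stands for $e_a \otimes e_b$.
\<close>

instantiation list :: (type) monoid_add
begin

definition zero_list :: "'a list" where "zero_list = []"

definition plus_list :: "'a list \<Rightarrow> 'a list \<Rightarrow> 'a list" where "plus_list xs ys = xs @ ys"

instance by standard (simp_all add: zero_list_def plus_list_def)

end

section \<open>The quadratic algebra of invariant forms\<close>

definition two_cycles :: "nat \<Rightarrow> (nat \<Rightarrow> nat) set" where
  "two_cycles N = {transpose i j | i j. i \<in> {1..N} \<and> j \<in> {1..N} \<and> i \<noteq> j}"

type_synonym 'k tens = "(nat \<Rightarrow> nat) list \<Rightarrow>\<^sub>0 'k"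

definition e :: "(nat \<Rightarrow> nat) \<Rightarrow> 'k::field tens" where
  "e a = Poly_Mapping.single [a] 1"

text \<open>The coefficient of \<open>e a\<close>.\<close>

definition coeff1 :: "'k::field tens \<Rightarrow> (nat \<Rightarrow> nat) \<Rightarrow> 'k" where
  "coeff1 x a = Poly_Mapping.lookup x [a]"

definition tensor_algebra :: "nat \<Rightarrow> 'k::field tens ring" where
  "tensor_algebra N =
    ring_of_type_algebra \<lparr>carrier := {x. Poly_Mapping.keys x \<subseteq> lists (two_cycles N)}\<rparr>"

text \<open>$\Lambda^1$ and $\Lambda^1 \otimes \Lambda^1$ are the pieces of degree 1 and 2 of the tensor algebra.\<close>

definition Lambda1 :: "nat \<Rightarrow> 'k::field tens set" where
  "Lambda1 N = pm.span (e ` two_cycles N)"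

definition Lambda1_2 :: "nat \<Rightarrow> 'k::field tens set" where
  "Lambda1_2 N = pm.span {e a * e b | a b. a \<in> two_cycles N \<and> b \<in> two_cycles N}"

definition conj_by :: "(nat \<Rightarrow> nat) \<Rightarrow> (nat \<Rightarrow> nat) \<Rightarrow> nat \<Rightarrow> nat" where
  "conj_by g a = g \<circ> a \<circ> inv' g"

text \<open>Linear extension of $e_a \otimes e_b \mapsto e_{aba^{-1}} \otimes e_a$.\<close>

definition Psi :: "nat \<Rightarrow> 'k::field tens \<Rightarrow> 'k tens" where
  "Psi N x = (\<Sum>a\<in>two_cycles N. \<Sum>b\<in>two_cycles N.
      pscale (Poly_Mapping.lookup x [a, b]) (e (conj_by a b) * e a))"

definition ker_id_minus_Psi :: "nat \<Rightarrow> 'k::field tens set" where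
  "ker_id_minus_Psi N = {x \<in> Lambda1_2 N. x - Psi N x = 0}"

definition quad_ideal :: "nat \<Rightarrow> 'k::field tens set" where
  "quad_ideal N = Idl\<^bsub>tensor_algebra N\<^esub> (ker_id_minus_Psi N)"

definition Lambda_quad :: "nat \<Rightarrow> 'k::field tens set ring" where
  "Lambda_quad N = tensor_algebra N Quot quad_ideal N"

definition proj :: "nat \<Rightarrow> 'k::field tens \<Rightarrow> 'k tens set" where
  "proj N x = quad_ideal N +>\<^bsub>tensor_algebra N\<^esub> x"

section \<open>Flat connections with constant coefficients\<close>

definition theta :: "nat \<Rightarrow> 'k::field tens" where
  "theta N = (\<Sum>a\<in>two_cycles N. e a)"

definition theta_i :: "nat \<Rightarrow> nat \<Rightarrow> 'k::field tens" where
  "theta_i N i = (\<Sum>j\<in>{1..N} - {i}. e (transpose i j))"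

text \<open>
  The exterior derivative on $\Lambda^1$, with values in degree 2 of the quadratic algebra:
  the linear extension of $\mathrm{d} e_a = \theta e_a + e_a \theta$, written on representatives.
\<close>

definition ext_d :: "nat \<Rightarrow> 'k::field tens \<Rightarrow> 'k tens set" where
  "ext_d N \<alpha> = proj N (\<Sum>a\<in>two_cycles N. pscale (coeff1 \<alpha> a) (theta N * e a + e a * theta N))"

definition curvature :: "nat \<Rightarrow> 'k::field tens \<Rightarrow> 'k tens set" where
  "curvature N \<alpha> =
    ext_d N \<alpha> \<oplus>\<^bsub>Lambda_quad N\<^esub> (proj N \<alpha> \<otimes>\<^bsub>Lambda_quad N\<^esub> proj N \<alpha>)"

definition flat_connections :: "nat \<Rightarrow> 'k::field tens set" where
  "flat_connections N = {\<alpha> \<in> Lambda1 N. curvature N \<alpha> = \<zero>\<^bsub>Lambda_quad N\<^esub>}"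

text \<open>Coefficients and cardinality of a connection \<open>\<alpha>\<close> refer to $\phi = \alpha + \theta$.\<close>

definition cardinality :: "nat \<Rightarrow> 'k::field tens \<Rightarrow> nat" where
  "cardinality N \<alpha> = card {a \<in> two_cycles N. coeff1 (\<alpha> + theta N) a \<noteq> 0}"

definition flat01 :: "nat \<Rightarrow> nat \<Rightarrow> 'k::field tens set" where
  "flat01 N n = {\<alpha> \<in> flat_connections N.
     (\<forall>a\<in>two_cycles N. coeff1 (\<alpha> + theta N) a \<in> {0, 1}) \<and> cardinality N \<alpha> = n}"

definition stratum :: "nat \<Rightarrow> nat \<Rightarrow> 'k::field tens set" where
  "stratum N n = (\<lambda>\<alpha>. \<alpha> + theta N) ` flat01 N n"

text \<open>
  The greatest cardinality below $|\mathcal{C}|$ of a nonempty stratum; the set is nonempty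
  as soon as \<open>N \<ge> 2\<close>, since \<open>stratum N 0 = {0}\<close>.
\<close>

definition submaximal_cardinality :: "'k::field itself \<Rightarrow> nat \<Rightarrow> nat" where
  "submaximal_cardinality K N =
    Max {n. n < card (two_cycles N) \<and> stratum N n \<noteq> ({} :: 'k tens set)}"

section \<open>Linear representations\<close>

text \<open>The components \<open>mult\<close> and \<open>one\<close> inherited from \<open>ring\<close> play no role for modules.\<close>

record ('g, 'k, 'v) rep = "('k, 'v) module" +
  act :: "'g \<Rightarrow> 'v \<Rightarrow> 'v"

definition linear_rep ::
  "('g, 'm) monoid_scheme \<Rightarrow> ('k, 'n) ring_scheme \<Rightarrow> ('g, 'k, 'v) rep \<Rightarrow> bool" where
  "linear_rep G K V \<longleftrightarrow>
    group G \<and> Ring.field K \<and> Module.module K V \<and>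
    (\<forall>g\<in>carrier G. \<forall>v\<in>carrier V. act V g v \<in> carrier V) \<and>
    (\<forall>g\<in>carrier G. \<forall>v\<in>carrier V. \<forall>w\<in>carrier V.
       act V g (v \<oplus>\<^bsub>V\<^esub> w) = act V g v \<oplus>\<^bsub>V\<^esub> act V g w) \<and>
    (\<forall>g\<in>carrier G. \<forall>c\<in>carrier K. \<forall>v\<in>carrier V.
       act V g (c \<odot>\<^bsub>V\<^esub> v) = c \<odot>\<^bsub>V\<^esub> act V g v) \<and>
    (\<forall>v\<in>carrier V. act V \<one>\<^bsub>G\<^esub> v = v) \<and>
    (\<forall>g\<in>carrier G. \<forall>h\<in>carrier G. \<forall>v\<in>carrier V.
       act V (g \<otimes>\<^bsub>G\<^esub> h) v = act V g (act V h v))"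

definition rep_iso ::
  "('g, 'm) monoid_scheme \<Rightarrow> ('k, 'n) ring_scheme \<Rightarrow> ('g, 'k, 'v) rep \<Rightarrow> ('g, 'k, 'w) rep
     \<Rightarrow> ('v \<Rightarrow> 'w) set" where
  "rep_iso G K V W = {f. bij_betw f (carrier V) (carrier W) \<and>
    (\<forall>v\<in>carrier V. \<forall>w\<in>carrier V. f (v \<oplus>\<^bsub>V\<^esub> w) = f v \<oplus>\<^bsub>W\<^esub> f w) \<and>
    (\<forall>c\<in>carrier K. \<forall>v\<in>carrier V. f (c \<odot>\<^bsub>V\<^esub> v) = c \<odot>\<^bsub>W\<^esub> f v) \<and>
    (\<forall>g\<in>carrier G. \<forall>v\<in>carrier V. f (act V g v) = act W g (f v))}"

text \<open>
  The quotient by a subrepresentation, given by its carrier \<open>W\<close>. In \<open>smult\<close> the summand \<open>W\<close>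
  is needed for the scalar \<open>0\<close>, as in \<^const>\<open>rcoset_mult\<close>.
\<close>

definition quot_rep :: "('g, 'k, 'v) rep \<Rightarrow> 'v set \<Rightarrow> ('g, 'k, 'v set) rep" where
  "quot_rep V W =
    \<lparr>carrier = a_rcosets\<^bsub>V\<^esub> W, mult = undefined, one = undefined,
     zero = W, add = set_add V,
     module.smult = (\<lambda>c A. \<Union>x\<in>A. W +>\<^bsub>V\<^esub> (c \<odot>\<^bsub>V\<^esub> x)),
     act = (\<lambda>g A. act V g ` A)\<rparr>"

definition sub_rep :: "('a \<Rightarrow>\<^sub>0 'k) set \<Rightarrow> ('g \<Rightarrow> ('a \<Rightarrow>\<^sub>0 'k) \<Rightarrow> ('a \<Rightarrow>\<^sub>0 'k)) \<Rightarrow>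
    ('g, 'k::field, 'a \<Rightarrow>\<^sub>0 'k) rep" where
  "sub_rep S \<rho> =
    \<lparr>carrier = S, mult = undefined, one = undefined,
     zero = 0, add = (+), module.smult = pscale, act = \<rho>\<rparr>"

definition act_Lambda1 :: "nat \<Rightarrow> (nat \<Rightarrow> nat) \<Rightarrow> 'k::field tens \<Rightarrow> 'k tens" where
  "act_Lambda1 N g x = (\<Sum>a\<in>two_cycles N. pscale (coeff1 x a) (e (conj_by g a)))"

text \<open>$V_n = kF_n / k\theta$; meaningful only if \<open>theta N\<close> lies in the span of the stratum.\<close>

definition stratum_module ::
  "nat \<Rightarrow> nat \<Rightarrow> (nat \<Rightarrow> nat, 'k::field, 'k tens set) rep" where
  "stratum_module N n =
    quot_rep (sub_rep (pm.span (stratum N n)) (act_Lambda1 N)) (pm.span {theta N})"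

text \<open>
  The standard representation: vectors in $k^N$ with coordinate sum zero, with $S_N$ permuting
  the basis vectors.
\<close>

definition act_perm :: "nat \<Rightarrow> (nat \<Rightarrow> nat) \<Rightarrow> (nat \<Rightarrow>\<^sub>0 'k::field) \<Rightarrow> (nat \<Rightarrow>\<^sub>0 'k)" where
  "act_perm N g x = (\<Sum>i\<in>{1..N}. Poly_Mapping.single (g i) (Poly_Mapping.lookup x i))"

definition standard_rep :: "nat \<Rightarrow> (nat \<Rightarrow> nat, 'k::field, nat \<Rightarrow>\<^sub>0 'k) rep" where
  "standard_rep N = sub_rep
     {x. Poly_Mapping.keys x \<subseteq> {1..N} \<and> (\<Sum>i\<in>{1..N}. Poly_Mapping.lookup x i) = 0}
     (act_perm N)"

end

theory Submission
  imports Defs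
begin

text \<open>
  Since $\theta \otimes \theta$ is fixed by the braiding, $F(\alpha) = \phi^2 - \theta^2$ vanishes
  in the quadratic algebra exactly if $\phi \otimes \phi$ is fixed by the braiding, that is,
  if $\phi^c \phi^d = \phi^d \phi^{dcd}$ for all 2-cycles $c, d$. For coefficients in $\{0,1\}$
  this says that the support of $\phi$ is closed under conjugation by its own elements, so, as
  a set of edges on $\{1,\dots,N\}$, it is a disjoint union of cliques. If it is not everything, it
  misses all edges between a clique $A$ and the complement $B$ of $A$, and
  $|A| |B| \ge N - 1$ with equality only if $A$ or $B$ is a single vertex $i$; then
  $\phi = \theta - \theta_i$.

  The span of the submaximal stratum consists of the combinations $\sum_i c_i \theta_i$, which
  determine $c$ if $N \ge 3$, and $\theta$ corresponds to the constant vector $1/2$. Hence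
  $c \mapsto \sum_i c_i \theta_i$ maps the vectors of coordinate sum zero isomorphically
  onto the quotient by $k\theta$.
\<close>

section \<open>Products of words and the braiding\<close>

lemma poly_mapping_sum_single:
  "x = (\<Sum>k\<in>Poly_Mapping.keys x. Poly_Mapping.single k (Poly_Mapping.lookup x k))"
  by (rule poly_mapping_eqI) (auto simp: lookup_sum lookup_single when_def in_keys_iff)

text \<open>A word \<open>w\<close> factors as \<open>take i w @ drop i w\<close> in
  \<open>length w + 1\<close> ways, and only \<open>i = length u\<close> can match \<open>u\<close>
  and \<open>v\<close>.\<close>

lemma lookup_mult_single_words:
  fixes c d :: "'k::field"
  shows "Poly_Mapping.lookup (Poly_Mapping.single u c * Poly_Mapping.single v d) w =
    (\<Sum>i\<le>length w. Poly_Mapping.lookup (Poly_Mapping.single u c) (take i w) *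
        Poly_Mapping.lookup (Poly_Mapping.single v d) (drop i w))"
proof -
  have "(\<Sum>i\<le>length w. (c when u = take i w) * (d when v = drop i w)) =
      (\<Sum>i\<le>length w. if i = length u then (c * d when u @ v = w) else 0)"
  proof (intro sum.cong refl)
    fix i assume "i \<in> {..length w}"
    then have split_iff: "u = take i w \<and> v = drop i w \<longleftrightarrow> i = length u \<and> u @ v = w"
      by auto
    have "(c when u = take i w) * (d when v = drop i w) =
        (c * d when u = take i w \<and> v = drop i w)"
      by (simp add: when_def)
    then show "(c when u = take i w) * (d when v = drop i w) =
        (if i = length u then (c * d when u @ v = w) else 0)"
      unfolding split_iff by (simp add: when_def)
  qed
  also have "\<dots> = (c * d when u @ v = w)"
    by (auto simp: when_def)
  finally show ?thesis
    by (simp add: mult_single lookup_single plus_list_def)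
qed

text \<open>Both sides are bilinear, so the case of single words extends. The sum does not depend on
  the supports of \<open>x\<close> and \<open>y\<close>, which turns degree arguments into case
  distinctions on the cut \<open>i\<close>.\<close>

lemma lookup_mult_words:
  fixes x y :: "'a list \<Rightarrow>\<^sub>0 'k::field"
  shows "Poly_Mapping.lookup (x * y) w =
    (\<Sum>i\<le>length w. Poly_Mapping.lookup x (take i w) * Poly_Mapping.lookup y (drop i w))"
proof -
  define s where "s z k = Poly_Mapping.single k (Poly_Mapping.lookup z k)"
    for z :: "'a list \<Rightarrow>\<^sub>0 'k" and k
  have s: "z = (\<Sum>k\<in>Poly_Mapping.keys z. s z k)" for z
    unfolding s_def by (rule poly_mapping_sum_single)
  have "Poly_Mapping.lookup (x * y) w =
      Poly_Mapping.lookup ((\<Sum>u\<in>Poly_Mapping.keys x. s x u) * (\<Sum>v\<in>Poly_Mapping.keys y. s y v)) w"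
    by (simp flip: s)
  also have "\<dots> = (\<Sum>u\<in>Poly_Mapping.keys x. \<Sum>v\<in>Poly_Mapping.keys y. \<Sum>i\<le>length w.
      Poly_Mapping.lookup (s x u) (take i w) * Poly_Mapping.lookup (s y v) (drop i w))"
    by (simp add: sum_product lookup_sum s_def lookup_mult_single_words)
  also have "\<dots> = (\<Sum>u\<in>Poly_Mapping.keys x. \<Sum>i\<le>length w. \<Sum>v\<in>Poly_Mapping.keys y.
      Poly_Mapping.lookup (s x u) (take i w) * Poly_Mapping.lookup (s y v) (drop i w))"
    by (intro sum.cong refl sum.swap)
  also have "\<dots> = (\<Sum>i\<le>length w. \<Sum>u\<in>Poly_Mapping.keys x. \<Sum>v\<in>Poly_Mapping.keys y.
      Poly_Mapping.lookup (s x u) (take i w) * Poly_Mapping.lookup (s y v) (drop i w))"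
    by (rule sum.swap)
  also have "\<dots> = (\<Sum>i\<le>length w. Poly_Mapping.lookup (\<Sum>u\<in>Poly_Mapping.keys x. s x u) (take i w) *
      Poly_Mapping.lookup (\<Sum>v\<in>Poly_Mapping.keys y. s y v) (drop i w))"
    by (simp add: sum_product lookup_sum)
  finally show ?thesis
    by (simp flip: s)
qed

lemma pscale_mult_left:
  fixes x y :: "'a list \<Rightarrow>\<^sub>0 'k::field"
  shows "pscale c x * y = pscale c (x * y)"
  by (rule poly_mapping_eqI) (simp add: lookup_mult_words sum_distrib_left mult.assoc)

lemma pscale_mult_right:
  fixes x y :: "'a list \<Rightarrow>\<^sub>0 'k::field"
  shows "x * pscale c y = pscale c (x * y)"
  by (rule poly_mapping_eqI) (simp add: lookup_mult_words sum_distrib_left mult.left_commute)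

section \<open>2-cycles and conjugation\<close>

lemma finite_two_cycles [simp]: "finite (two_cycles N)"
proof -
  have "two_cycles N \<subseteq> (\<lambda>(i, j). transpose i j) ` ({1..N} \<times> {1..N})"
    by (auto simp: two_cycles_def)
  then show ?thesis
    by (rule finite_subset) simp
qed

lemma two_cycles_comp_self: "a \<in> two_cycles N \<Longrightarrow> a (a x) = x"
  by (auto simp: two_cycles_def)

lemma two_cycles_inv: "a \<in> two_cycles N \<Longrightarrow> inv' a = a"
  by (auto simp: two_cycles_def)

lemma two_cycles_permutes: "a \<in> two_cycles N \<Longrightarrow> a permutes {1..N}"
  by (auto simp: two_cycles_def intro!: permutes_swap_id)

lemma conj_by_transpose:
  assumes "bij g"
  shows "conj_by g (transpose i j) = transpose (g i) (g j)"
proof -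
  have "g \<circ> transpose i j = transpose (g i) (g j) \<circ> g"
    using transpose_comp_eq[OF assms, of "g i" "g j"] assms by (simp add: bij_is_inj)
  then show ?thesis
    using assms by (simp add: conj_by_def comp_assoc surj_iff[THEN iffD1] bij_is_surj)
qed

lemma conj_by_two_cycles:
  assumes "g permutes {1..N}" "a \<in> two_cycles N"
  shows "conj_by g a \<in> two_cycles N"
proof -
  obtain i j where "a = transpose i j" "i \<in> {1..N}" "j \<in> {1..N}" "i \<noteq> j"
    using assms(2) by (auto simp: two_cycles_def)
  moreover have "g i \<in> {1..N}" "g j \<in> {1..N}" "g i \<noteq> g j"
    using calculation permutes_in_image[OF assms(1)] permutes_inj[OF assms(1)]
    by (auto dest: injD simp del: atLeastAtMost_iff)
  ultimately show ?thesis
    unfolding two_cycles_def using conj_by_transpose[OF permutes_bij[OF assms(1)]] by blast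
qed

text \<open>A 2-cycle is its own inverse, so conjugation by it is an involution.\<close>

lemma conj_by_eq_iff:
  assumes "a \<in> two_cycles N"
  shows "conj_by a b = c \<longleftrightarrow> b = conj_by a c"
  using two_cycles_inv[OF assms] two_cycles_comp_self[OF assms]
  by (simp add: conj_by_def fun_eq_iff) metis

lemma conj_by_mem_iff:
  assumes "a \<in> two_cycles N"
  shows "conj_by a b \<in> two_cycles N \<longleftrightarrow> b \<in> two_cycles N"
  by (metis assms conj_by_eq_iff conj_by_two_cycles two_cycles_permutes)

section \<open>Coefficients in degree 1\<close>

lemma e_mult_e: "e a * e b = (Poly_Mapping.single [a, b] 1 :: 'k::field tens)"
  by (simp add: e_def mult_single plus_list_def)

lemma lookup_e_mult_e:
  "Poly_Mapping.lookup (e a * e b :: 'k::field tens) w = (if w = [a, b] then 1 else 0)"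
  by (simp add: e_mult_e lookup_single when_def)

lemma coeff1_simps [simp]:
  "coeff1 (e a) b = (if a = b then 1 else 0)"
  "coeff1 (x + y) b = coeff1 x b + coeff1 y b"
  "coeff1 (- x) b = - coeff1 x b"
  "coeff1 (x - y) b = coeff1 x b - coeff1 y b"
  "coeff1 0 b = 0"
  "coeff1 (pscale c x) b = c * coeff1 x b"
  by (simp_all add: coeff1_def e_def lookup_single when_def lookup_add lookup_minus)

lemma coeff1_sum [simp]: "coeff1 (sum f A) b = (\<Sum>a\<in>A. coeff1 (f a) b)"
  by (simp add: coeff1_def lookup_sum)

lemma e_in_Lambda1 [simp]: "a \<in> two_cycles N \<Longrightarrow> e a \<in> Lambda1 N"
  by (auto simp: Lambda1_def intro: pm.span_base)

lemma Lambda1_expand: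
  assumes "x \<in> Lambda1 N"
  shows "x = (\<Sum>a\<in>two_cycles N. pscale (coeff1 x a) (e a))"
  using assms unfolding Lambda1_def
proof (induction rule: pm.span_induct_alt)
  case base
  show ?case by simp
next
  case (step c x y)
  then obtain a where a: "x = e a" "a \<in> two_cycles N" by auto
  have "(\<Sum>b\<in>two_cycles N. pscale (coeff1 (pscale c x + y) b) (e b)) =
    (\<Sum>b\<in>two_cycles N. if b = a then pscale c (e a) else 0) +
    (\<Sum>b\<in>two_cycles N. pscale (coeff1 y b) (e b))"
    unfolding sum.distrib[symmetric]
    by (rule sum.cong) (auto simp: a pm.scale_left_distrib)
  also have "\<dots> = pscale c x + y"
    using a step by simp
  finally show ?case by simp
qed

lemma Lambda1_eqI:
  assumes "x \<in> Lambda1 N" "y \<in> Lambda1 N"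
    "\<And>a. a \<in> two_cycles N \<Longrightarrow> coeff1 x a = coeff1 y a"
  shows "x = y"
proof -
  have "(\<Sum>a\<in>two_cycles N. pscale (coeff1 x a) (e a)) =
      (\<Sum>a\<in>two_cycles N. pscale (coeff1 y a) (e a))"
    by (rule sum.cong) (simp_all add: assms(3))
  then show ?thesis
    using assms(1,2)[THEN Lambda1_expand] by simp
qed

lemma Lambda1_subspace: "pm.subspace (Lambda1 N)"
  by (simp add: Lambda1_def)

lemmas Lambda1_closed [simp, intro] =
  pm.subspace_add[OF Lambda1_subspace] pm.subspace_neg[OF Lambda1_subspace]
  pm.subspace_diff[OF Lambda1_subspace] pm.subspace_scale[OF Lambda1_subspace]
  pm.subspace_sum[OF Lambda1_subspace] pm.subspace_0[OF Lambda1_subspace]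

lemma theta_in_Lambda1 [simp]: "theta N \<in> Lambda1 N"
  by (auto simp: theta_def)

lemma coeff1_theta: "a \<in> two_cycles N \<Longrightarrow> coeff1 (theta N) a = 1"
  by (simp add: theta_def)

section \<open>The tensor algebra and its piece of degree 2\<close>

lemma carrier_tensor_algebra:
  "x \<in> carrier (tensor_algebra N) \<longleftrightarrow> Poly_Mapping.keys x \<subseteq> lists (two_cycles N)"
  by (simp add: tensor_algebra_def)

lemma tensor_algebra_simps:
  "x \<oplus>\<^bsub>tensor_algebra N\<^esub> y = x + y"
  "x \<otimes>\<^bsub>tensor_algebra N\<^esub> y = x * y"
  "\<zero>\<^bsub>tensor_algebra N\<^esub> = 0"
  "\<one>\<^bsub>tensor_algebra N\<^esub> = 1"
  by (simp_all add: tensor_algebra_def ring_of_type_algebra_def)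

lemma tensor_algebra_closed:
  fixes x y :: "'k::field tens"
  shows "(0 :: 'k tens) \<in> carrier (tensor_algebra N)" "(1 :: 'k tens) \<in> carrier (tensor_algebra N)"
    "x \<in> carrier (tensor_algebra N) \<Longrightarrow> - x \<in> carrier (tensor_algebra N)"
    "x \<in> carrier (tensor_algebra N) \<Longrightarrow> pscale c x \<in> carrier (tensor_algebra N)"
    "x \<in> carrier (tensor_algebra N) \<Longrightarrow> y \<in> carrier (tensor_algebra N) \<Longrightarrow>
      x + y \<in> carrier (tensor_algebra N)"
    "x \<in> carrier (tensor_algebra N) \<Longrightarrow> y \<in> carrier (tensor_algebra N) \<Longrightarrow>
      x * y \<in> carrier (tensor_algebra N)"
proof -
  show "(0 :: 'k tens) \<in> carrier (tensor_algebra N)"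
    by (simp add: carrier_tensor_algebra)
  show "(1 :: 'k tens) \<in> carrier (tensor_algebra N)"
    by (simp add: carrier_tensor_algebra zero_list_def)
  show "x \<in> carrier (tensor_algebra N) \<Longrightarrow> - x \<in> carrier (tensor_algebra N)"
    by (auto simp: carrier_tensor_algebra in_keys_iff subset_iff)
  show "x \<in> carrier (tensor_algebra N) \<Longrightarrow> pscale c x \<in> carrier (tensor_algebra N)"
    by (auto simp: carrier_tensor_algebra in_keys_iff subset_iff)
  show "x + y \<in> carrier (tensor_algebra N)"
    if "x \<in> carrier (tensor_algebra N)" "y \<in> carrier (tensor_algebra N)"
    using that keys_add[of x y] unfolding carrier_tensor_algebra by blast
  show "x * y \<in> carrier (tensor_algebra N)"
    if "x \<in> carrier (tensor_algebra N)" "y \<in> carrier (tensor_algebra N)"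
    using that keys_mult[of x y] unfolding carrier_tensor_algebra
    by (fastforce simp: plus_list_def)
qed

lemma Lambda1_carrier: "x \<in> Lambda1 N \<Longrightarrow> x \<in> carrier (tensor_algebra N)"
  unfolding Lambda1_def
proof (induction rule: pm.span_induct_alt)
  case (step c x y)
  then show ?case
    by (intro tensor_algebra_closed) (auto simp: carrier_tensor_algebra e_def)
qed (rule tensor_algebra_closed)

lemma Lambda1_2_carrier: "x \<in> Lambda1_2 N \<Longrightarrow> x \<in> carrier (tensor_algebra N)"
  unfolding Lambda1_2_def
proof (induction rule: pm.span_induct_alt)
  case (step c x y)
  then show ?case
    by (intro tensor_algebra_closed) (auto simp: carrier_tensor_algebra e_mult_e)
qed (rule tensor_algebra_closed)

lemma Lambda1_2_lookup:
  "x \<in> Lambda1_2 N \<Longrightarrow> length w \<noteq> 2 \<Longrightarrow> Poly_Mapping.lookup x w = 0"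
  unfolding Lambda1_2_def
  by (induction rule: pm.span_induct_alt) (auto simp: lookup_add lookup_e_mult_e split: if_splits)

lemma Lambda1_mult:
  assumes "x \<in> Lambda1 N" "y \<in> Lambda1 N"
  shows "x * y = (\<Sum>a\<in>two_cycles N. \<Sum>b\<in>two_cycles N. pscale (coeff1 x a * coeff1 y b) (e a * e b))"
  by (subst Lambda1_expand[OF assms(1)], subst Lambda1_expand[OF assms(2)])
    (simp add: sum_product pscale_mult_left pscale_mult_right mult.commute)

lemma Lambda1_mult_in_Lambda1_2:
  assumes "x \<in> Lambda1 N" "y \<in> Lambda1 N"
  shows "x * y \<in> Lambda1_2 N"
  unfolding Lambda1_mult[OF assms] Lambda1_2_def
  by (intro pm.span_sum pm.span_scale pm.span_base) auto

lemma lookup_Lambda1_mult: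
  assumes "x \<in> Lambda1 N" "y \<in> Lambda1 N"
  shows "Poly_Mapping.lookup (x * y) [a, b] = coeff1 x a * coeff1 y b"
proof -
  \<comment> \<open>Of the three factorizations of \<open>[a, b]\<close>, the two with an empty
    factor drop out because elements of \<open>Lambda1 N\<close> have no constant term.\<close>
  have "Poly_Mapping.lookup z [] = 0" if "z \<in> Lambda1 N" for z :: "'a tens"
    using that unfolding Lambda1_def
    by (induction rule: pm.span_induct_alt) (auto simp: lookup_add e_def lookup_single)
  then show ?thesis
    using assms by (simp add: lookup_mult_words coeff1_def numeral_2_eq_2 atMost_Suc)
qed

section \<open>The braiding on words of length 2\<close>

lemma lookup_Psi:
  fixes x :: "'k::field tens"
  assumes "c \<in> two_cycles N" "d \<in> two_cycles N"
  shows "Poly_Mapping.lookup (Psi N x) [c, d] = Poly_Mapping.lookup x [d, conj_by d c]"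
proof -
  \<comment> \<open>The braiding permutes the words of length 2 in the 2-cycles:
    \<open>[c, d]\<close> is the image of \<open>[a, b]\<close> exactly if \<open>a = d\<close> and
    \<open>conj_by d b = c\<close>, so a single term survives.\<close>
  have "Poly_Mapping.lookup (Psi N x) [c, d] =
     (\<Sum>a\<in>two_cycles N. \<Sum>b\<in>two_cycles N.
       if a = d then (if b = conj_by d c then Poly_Mapping.lookup x [d, conj_by d c] else 0) else 0)"
    unfolding Psi_def lookup_sum
  proof (intro sum.cong refl)
    fix a b
    show "Poly_Mapping.lookup (pscale (Poly_Mapping.lookup x [a, b]) (e (conj_by a b) * e a)) [c, d] =
      (if a = d then (if b = conj_by d c then Poly_Mapping.lookup x [d, conj_by d c] else 0) else 0)"
      using conj_by_eq_iff[OF assms(2), of b c] by (auto simp: lookup_e_mult_e)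
  qed
  also have "\<dots> = (\<Sum>a\<in>two_cycles N. if a = d then Poly_Mapping.lookup x [d, conj_by d c] else 0)"
    by (rule sum.cong) (use assms in \<open>simp_all add: conj_by_mem_iff\<close>)
  finally show ?thesis
    using assms by simp
qed

lemma Psi_in_Lambda1_2: "Psi N x \<in> Lambda1_2 N"
  unfolding Psi_def Lambda1_2_def
  by (intro pm.span_sum pm.span_scale pm.span_base)
    (use conj_by_two_cycles two_cycles_permutes in blast)

text \<open>Invariance under the braiding as a linear condition on coefficients. In this form it
  makes sense for tensors of mixed degree, so that it can be used to cut out an ideal.\<close>

definition braid_symmetric :: "nat \<Rightarrow> 'k::field tens \<Rightarrow> bool" where
  "braid_symmetric N x \<longleftrightarrow> (\<forall>c\<in>two_cycles N. \<forall>d\<in>two_cycles N.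
     Poly_Mapping.lookup x [c, d] = Poly_Mapping.lookup x [d, conj_by d c])"

text \<open>Both \<open>x\<close> and \<open>Psi N x\<close> lie in \<open>Lambda1_2 N\<close>, so
  they vanish on all words except \<open>[c, d]\<close> with 2-cycles \<open>c\<close> and
  \<open>d\<close>, where \<open>lookup_Psi\<close> applies.\<close>

lemma ker_iff_braid_symmetric:
  assumes "x \<in> Lambda1_2 N"
  shows "x \<in> ker_id_minus_Psi N \<longleftrightarrow> braid_symmetric N x"
proof
  assume "x \<in> ker_id_minus_Psi N"
  then have "Psi N x = x" by (simp add: ker_id_minus_Psi_def)
  then show "braid_symmetric N x"
    unfolding braid_symmetric_def by (metis lookup_Psi)
next
  assume sym: "braid_symmetric N x"
  have "Poly_Mapping.lookup x w = Poly_Mapping.lookup (Psi N x) w" for w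
  proof (cases "length w = 2 \<and> w \<in> lists (two_cycles N)")
    case True
    then obtain c d where "w = [c, d]" "c \<in> two_cycles N" "d \<in> two_cycles N"
      by (auto simp: numeral_2_eq_2 length_Suc_conv)
    then show ?thesis
      using sym by (simp add: braid_symmetric_def lookup_Psi)
  next
    case False
    then consider "length w \<noteq> 2" | "w \<notin> lists (two_cycles N)" by blast
    then show ?thesis
    proof cases
      case 1
      then show ?thesis
        using Lambda1_2_lookup[OF assms] Lambda1_2_lookup[OF Psi_in_Lambda1_2] by metis
    next
      case 2
      then have "w \<notin> Poly_Mapping.keys x" "w \<notin> Poly_Mapping.keys (Psi N x)"
        using Lambda1_2_carrier[OF assms] Lambda1_2_carrier[OF Psi_in_Lambda1_2]
        unfolding carrier_tensor_algebra by blast+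
      then show ?thesis by (simp add: in_keys_iff)
    qed
  qed
  then have "x = Psi N x" by (rule poly_mapping_eqI)
  then show "x \<in> ker_id_minus_Psi N"
    using assms by (simp add: ker_id_minus_Psi_def)
qed

section \<open>The quadratic ideal in degree 2\<close>

lemma ring_tensor_algebra: "ring (tensor_algebra N :: 'k::field tens ring)"
proof -
  have "\<exists>y\<in>carrier (tensor_algebra N). y + x = 0" if "x \<in> carrier (tensor_algebra N)" for x :: "'k tens"
    using that by (intro bexI[of _ "- x"]) (auto intro: tensor_algebra_closed)
  then show ?thesis
    by (intro ringI abelian_groupI monoidI)
      (auto simp: tensor_algebra_simps tensor_algebra_closed algebra_simps)
qed

lemma a_inv_tensor_algebra:
  assumes "x \<in> carrier (tensor_algebra N)"
  shows "\<ominus>\<^bsub>tensor_algebra N\<^esub> x = - (x :: 'k::field tens)"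
proof -
  interpret ring "tensor_algebra N :: 'k tens ring" by (rule ring_tensor_algebra)
  show ?thesis
    by (rule minus_equality) (use assms in \<open>simp_all add: tensor_algebra_simps tensor_algebra_closed\<close>)
qed

text \<open>An ideal cutting out the degree-2 part of the defining relations, so that the quadratic
  ideal contains no further elements of degree 2.\<close>

lemma ideal_braid_symmetric:
  "ideal {x \<in> carrier (tensor_algebra N :: 'k::field tens ring).
     (\<forall>w. length w < 2 \<longrightarrow> Poly_Mapping.lookup x w = 0) \<and> braid_symmetric N x} (tensor_algebra N)"
    (is "ideal ?I _")
proof -
  interpret ring "tensor_algebra N :: 'k tens ring" by (rule ring_tensor_algebra)
  have low: "Poly_Mapping.lookup (y * x) w = 0 \<and> Poly_Mapping.lookup (x * y) w = 0"
    if "\<forall>w. length w < 2 \<longrightarrow> Poly_Mapping.lookup x w = 0" "length w < 2" for x y :: "'k tens" and w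
  proof -
    have "Poly_Mapping.lookup x (take i w) = 0" "Poly_Mapping.lookup x (drop i w) = 0" for i
      using that by auto
    then show ?thesis by (simp add: lookup_mult_words)
  qed
  \<comment> \<open>Since \<open>x\<close> starts in degree 2, multiplication by \<open>y\<close>
    scales its degree-2 part by the constant term of \<open>y\<close>, which preserves a linear
    condition on that part.\<close>
  have two: "Poly_Mapping.lookup (y * x) [a, b] = Poly_Mapping.lookup y [] * Poly_Mapping.lookup x [a, b]"
    "Poly_Mapping.lookup (x * y) [a, b] = Poly_Mapping.lookup x [a, b] * Poly_Mapping.lookup y []"
    if "\<forall>w. length w < 2 \<longrightarrow> Poly_Mapping.lookup x w = 0" for x y :: "'k tens" and a b
    using that by (auto simp: lookup_mult_words numeral_2_eq_2 atMost_Suc)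
  have "subgroup ?I (add_monoid (tensor_algebra N))"
  proof (rule group.subgroupI)
    show "group (add_monoid (tensor_algebra N :: 'k tens ring))"
      by (rule a_group)
    have "0 \<in> ?I" by (simp add: tensor_algebra_closed braid_symmetric_def)
    then show "?I \<noteq> {}" by blast
    show "inv\<^bsub>add_monoid (tensor_algebra N)\<^esub> x \<in> ?I" if "x \<in> ?I" for x
      using that a_inv_tensor_algebra[of x N] unfolding a_inv_def
      by (simp add: tensor_algebra_closed braid_symmetric_def)
  qed (auto simp: tensor_algebra_simps tensor_algebra_closed braid_symmetric_def lookup_add)
  then show ?thesis
    using low two
    by (intro idealI ring_tensor_algebra)
      (auto simp: tensor_algebra_simps tensor_algebra_closed braid_symmetric_def)
qed

lemma quad_ideal_props:
  shows ideal_quad_ideal: "ideal (quad_ideal N) (tensor_algebra N :: 'k::field tens ring)"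
    and ker_subset_quad_ideal: "ker_id_minus_Psi N \<subseteq> (quad_ideal N :: 'k tens set)"
proof -
  interpret ring "tensor_algebra N :: 'k tens ring" by (rule ring_tensor_algebra)
  have sub: "ker_id_minus_Psi N \<subseteq> carrier (tensor_algebra N :: 'k tens ring)"
    using Lambda1_2_carrier by (auto simp: ker_id_minus_Psi_def)
  show "ideal (quad_ideal N) (tensor_algebra N :: 'k tens ring)"
    unfolding quad_ideal_def by (rule genideal_ideal[OF sub])
  show "ker_id_minus_Psi N \<subseteq> (quad_ideal N :: 'k tens set)"
    unfolding quad_ideal_def by (rule genideal_self[OF sub])
qed

text \<open>The relations generate nothing new in degree 2: by minimality the generated ideal is
  contained in the one of \<open>ideal_braid_symmetric\<close>. Conversely, a symmetric
  \<open>x\<close> is itself a generator.\<close>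

lemma quad_ideal_degree_2:
  fixes x :: "'k::field tens"
  assumes "x \<in> Lambda1_2 N"
  shows "x \<in> quad_ideal N \<longleftrightarrow> braid_symmetric N x"
proof
  interpret ring "tensor_algebra N :: 'k tens ring" by (rule ring_tensor_algebra)
  assume x: "x \<in> quad_ideal N"
  have "quad_ideal N \<subseteq> {x \<in> carrier (tensor_algebra N :: 'k tens ring).
     (\<forall>w. length w < 2 \<longrightarrow> Poly_Mapping.lookup x w = 0) \<and> braid_symmetric N x}"
    unfolding quad_ideal_def
  proof (rule genideal_minimal[OF ideal_braid_symmetric], safe)
    fix y :: "'k tens" assume y: "y \<in> ker_id_minus_Psi N"
    then have y2: "y \<in> Lambda1_2 N" by (simp add: ker_id_minus_Psi_def)
    show "y \<in> carrier (tensor_algebra N)" "braid_symmetric N y"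
      using y y2 Lambda1_2_carrier ker_iff_braid_symmetric by blast+
    show "Poly_Mapping.lookup y w = 0" if "length w < 2" for w
      using Lambda1_2_lookup[OF y2] that by simp
  qed
  then show "braid_symmetric N x" using x by blast
next
  assume "braid_symmetric N x"
  then show "x \<in> quad_ideal N"
    using ker_iff_braid_symmetric[OF assms] ker_subset_quad_ideal by blast
qed

section \<open>Flatness as a condition on coefficients\<close>

lemma braid_symmetric_square_iff:
  assumes "\<phi> \<in> Lambda1 N"
  shows "braid_symmetric N (\<phi> * \<phi>) \<longleftrightarrow> (\<forall>c\<in>two_cycles N. \<forall>d\<in>two_cycles N.
    coeff1 \<phi> c * coeff1 \<phi> d = coeff1 \<phi> d * coeff1 \<phi> (conj_by d c))"
  by (simp add: braid_symmetric_def lookup_Lambda1_mult[OF assms assms])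

text \<open>All coefficients of \<open>theta N\<close> on the class are 1, and conjugation by
  2-cycles preserves the class.\<close>

lemma braid_symmetric_theta_square: "braid_symmetric N (theta N * theta N)"
  by (simp add: braid_symmetric_square_iff coeff1_theta conj_by_mem_iff)

text \<open>On representatives the derivative of \<open>\<alpha>\<close> is
  \<open>theta N * \<alpha> + \<alpha> * theta N\<close>; completing the square leaves the
  correction \<open>theta N * theta N\<close>.\<close>

lemma curvature_eq:
  fixes \<alpha> :: "'k::field tens"
  assumes "\<alpha> \<in> Lambda1 N"
  shows "curvature N \<alpha> = proj N ((\<alpha> + theta N) * (\<alpha> + theta N) - theta N * theta N)"
proof -
  interpret I: ideal "quad_ideal N" "tensor_algebra N :: 'k tens ring"
    by (rule ideal_quad_ideal)
  have "(\<Sum>a\<in>two_cycles N. pscale (coeff1 \<alpha> a) (theta N * e a + e a * theta N)) =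
      theta N * (\<Sum>a\<in>two_cycles N. pscale (coeff1 \<alpha> a) (e a)) +
      (\<Sum>a\<in>two_cycles N. pscale (coeff1 \<alpha> a) (e a)) * theta N"
    by (simp add: sum_distrib_left sum_distrib_right sum.distrib pscale_mult_left
        pscale_mult_right pm.scale_right_distrib)
  then have d: "ext_d N \<alpha> = proj N (theta N * \<alpha> + \<alpha> * theta N)"
    using Lambda1_expand[OF assms] by (simp add: ext_d_def)
  have c: "theta N \<in> carrier (tensor_algebra N :: 'k tens ring)" "\<alpha> \<in> carrier (tensor_algebra N)"
    using assms by (simp_all add: Lambda1_carrier)
  have "proj N x \<oplus>\<^bsub>Lambda_quad N\<^esub> proj N y = proj N (x + y)"
    if "x \<in> carrier (tensor_algebra N)" "y \<in> carrier (tensor_algebra N)" for x y :: "'k tens"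
    using I.a_rcos_sum[OF that]
    by (simp add: proj_def Lambda_quad_def FactRing_def tensor_algebra_simps)
  moreover have "proj N x \<otimes>\<^bsub>Lambda_quad N\<^esub> proj N y = proj N (x * y)"
    if "x \<in> carrier (tensor_algebra N)" "y \<in> carrier (tensor_algebra N)" for x y :: "'k tens"
    using I.rcoset_mult_add[OF that]
    by (simp add: proj_def Lambda_quad_def FactRing_def tensor_algebra_simps)
  ultimately show ?thesis
    using c by (simp add: curvature_def d tensor_algebra_closed algebra_simps)
qed

text \<open>The correction \<open>theta N * theta N\<close> is itself symmetric, so subtracting it
  does not affect the linear condition that decides membership in the ideal.\<close>

lemma flat_iff:
  fixes \<alpha> :: "'k::field tens"
  assumes "\<alpha> \<in> Lambda1 N"
  shows "\<alpha> \<in> flat_connections N \<longleftrightarrow> braid_symmetric N ((\<alpha> + theta N) * (\<alpha> + theta N))"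
proof -
  interpret I: ideal "quad_ideal N" "tensor_algebra N :: 'k tens ring"
    by (rule ideal_quad_ideal)
  let ?x = "(\<alpha> + theta N) * (\<alpha> + theta N) - theta N * theta N"
  have x2: "?x \<in> Lambda1_2 N"
    using assms Lambda1_mult_in_Lambda1_2[of "\<alpha> + theta N" N "\<alpha> + theta N"]
      Lambda1_mult_in_Lambda1_2[of "theta N :: 'k tens" N "theta N"]
    by (auto simp: Lambda1_2_def intro!: pm.span_diff)
  have "curvature N \<alpha> = \<zero>\<^bsub>Lambda_quad N\<^esub> \<longleftrightarrow> ?x \<in> quad_ideal N"
    unfolding curvature_eq[OF assms] proj_def Lambda_quad_def FactRing_def
    using I.a_rcos_const I.a_rcos_self[OF Lambda1_2_carrier[OF x2]] by auto
  also have "\<dots> \<longleftrightarrow> braid_symmetric N ((\<alpha> + theta N) * (\<alpha> + theta N))"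
    unfolding quad_ideal_degree_2[OF x2]
    using braid_symmetric_theta_square[where 'a='k, of N]
    by (simp add: braid_symmetric_def lookup_minus)
  finally show ?thesis
    using assms by (simp add: flat_connections_def)
qed

section \<open>Strata of flat connections\<close>

text \<open>For sets of 2-cycles these are the subracks of the conjugation rack; conjugation by
  \<open>d\<close> is undone by \<open>d\<close> itself.\<close>

definition conj_closed :: "(nat \<Rightarrow> nat) set \<Rightarrow> bool" where
  "conj_closed S \<longleftrightarrow> (\<forall>c\<in>S. \<forall>d\<in>S. conj_by d c \<in> S)"

lemma coeff1_sum_e:
  "finite S \<Longrightarrow> coeff1 (\<Sum>a\<in>S. e a) c = (if c \<in> S then 1 else 0)"
  by simp

lemma sum_e_in_Lambda1: "S \<subseteq> two_cycles N \<Longrightarrow> (\<Sum>a\<in>S. e a) \<in> Lambda1 N"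
  by (intro Lambda1_closed) auto

lemma flat_sum_e_iff:
  assumes S: "S \<subseteq> two_cycles N"
  shows "(\<Sum>a\<in>S. e a) - theta N \<in> (flat_connections N :: 'k::field tens set) \<longleftrightarrow> conj_closed S"
proof -
  have fin: "finite S" using S finite_subset finite_two_cycles by blast
  let ?\<phi> = "\<Sum>a\<in>S. e a :: 'k tens"
  have \<phi>: "?\<phi> \<in> Lambda1 N" by (rule sum_e_in_Lambda1[OF S])
  have "?\<phi> - theta N \<in> flat_connections N \<longleftrightarrow> braid_symmetric N (?\<phi> * ?\<phi>)"
    using flat_iff[of "?\<phi> - theta N" N] \<phi> by simp
  \<comment> \<open>For \<open>d\<close> outside \<open>S\<close> both sides of the equation are 0;
    for \<open>d\<close> in \<open>S\<close> the factor 1 cancels and two indicator values are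
    compared.\<close>
  also have "\<dots> \<longleftrightarrow> (\<forall>c\<in>two_cycles N. \<forall>d\<in>S. c \<in> S \<longleftrightarrow> conj_by d c \<in> S)"
    unfolding braid_symmetric_square_iff[OF \<phi>] coeff1_sum_e[OF fin] using S by auto
  \<comment> \<open>Conjugating by \<open>d\<close> twice is the identity, so the backward
    implication follows from the forward one.\<close>
  also have "\<dots> \<longleftrightarrow> conj_closed S"
    unfolding conj_closed_def using S conj_by_eq_iff by (metis subsetD)
  finally show ?thesis .
qed

text \<open>A vector with entries in \<open>{0, 1}\<close> amounts to its support, which reduces the
  strata to the combinatorics of sets of 2-cycles.\<close>

lemma flat01_eq:
  "flat01 N n = (\<lambda>S. (\<Sum>a\<in>S. e a) - theta N :: 'k::field tens) `
     {S. S \<subseteq> two_cycles N \<and> conj_closed S \<and> card S = n}"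
proof (intro Set.set_eqI iffI)
  fix \<alpha> :: "'k tens"
  assume \<alpha>: "\<alpha> \<in> flat01 N n"
  define S where "S = {a \<in> two_cycles N. coeff1 (\<alpha> + theta N) a \<noteq> 0}"
  have S: "S \<subseteq> two_cycles N" "finite S" by (auto simp: S_def)
  have "\<alpha> \<in> Lambda1 N" using \<alpha> by (simp add: flat01_def flat_connections_def)
  moreover have "coeff1 (\<alpha> + theta N) a = coeff1 (\<Sum>a\<in>S. e a) a" if "a \<in> two_cycles N" for a
    using \<alpha> that unfolding coeff1_sum_e[OF S(2)] by (auto simp: flat01_def S_def)
  ultimately have eq: "\<alpha> = (\<Sum>a\<in>S. e a) - theta N"
    using Lambda1_eqI[of "\<alpha> + theta N" N "\<Sum>a\<in>S. e a"] sum_e_in_Lambda1[OF S(1)]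
    by (simp add: algebra_simps)
  moreover have "conj_closed S" "card S = n"
  proof -
    have "\<alpha> \<in> flat_connections N" "cardinality N \<alpha> = n"
      using \<alpha> by (simp_all add: flat01_def)
    then show "conj_closed S" "card S = n"
      using flat_sum_e_iff[OF S(1), where 'k='k] unfolding eq[symmetric]
      by (simp_all add: cardinality_def S_def)
  qed
  ultimately show "\<alpha> \<in> (\<lambda>S. (\<Sum>a\<in>S. e a) - theta N) `
     {S. S \<subseteq> two_cycles N \<and> conj_closed S \<and> card S = n}"
    using S(1) by blast
next
  fix \<alpha> :: "'k tens"
  assume "\<alpha> \<in> (\<lambda>S. (\<Sum>a\<in>S. e a) - theta N) `
     {S. S \<subseteq> two_cycles N \<and> conj_closed S \<and> card S = n}"
  then obtain S where S: "S \<subseteq> two_cycles N" "conj_closed S" "card S = n"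
    and \<alpha>: "\<alpha> = (\<Sum>a\<in>S. e a) - theta N"
    by blast
  have fin: "finite S" using S(1) finite_subset finite_two_cycles by blast
  have "{a \<in> two_cycles N. coeff1 (\<alpha> + theta N) a \<noteq> 0} = S"
    using S(1) unfolding \<alpha> by (auto simp: fin)
  then show "\<alpha> \<in> flat01 N n"
    using flat_sum_e_iff[OF S(1)] S(2,3) unfolding \<alpha> flat01_def cardinality_def
    by (simp add: fin)
qed

section \<open>Sets of 2-cycles as edge sets: stars and cliques\<close>

lemma transpose_eq_transpose_iff:
  assumes "i \<noteq> j" "k \<noteq> l"
  shows "transpose i j = transpose k l \<longleftrightarrow> i = k \<and> j = l \<or> i = l \<and> j = k"
proof
  assume eq: "transpose i j = transpose k l"
  show "i = k \<and> j = l \<or> i = l \<and> j = k"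
    using fun_cong[OF eq, of i] assms by (auto simp: transpose_def split: if_splits)
qed (auto simp: transpose_commute)

definition star :: "nat \<Rightarrow> nat \<Rightarrow> (nat \<Rightarrow> nat) set" where
  "star N i = transpose i ` ({1..N} - {i})"

lemma inj_on_transpose_star: "inj_on (transpose i) (A - {i})"
  by (rule inj_onI) (metis transpose_apply_first)

lemma theta_i_eq_sum_star: "theta_i N i = (\<Sum>a\<in>star N i. e a)"
  by (simp add: theta_i_def star_def sum.reindex inj_on_transpose_star)

lemma star_subset: "i \<in> {1..N} \<Longrightarrow> star N i \<subseteq> two_cycles N"
  unfolding star_def two_cycles_def by blast

lemma card_star: "i \<in> {1..N} \<Longrightarrow> card (star N i) = N - 1"
  by (simp add: star_def card_image inj_on_transpose_star)

lemma transpose_in_star_iff: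
  assumes "i \<in> {1..N}" "k \<in> {1..N}" "l \<in> {1..N}" "k \<noteq> l"
  shows "transpose k l \<in> star N i \<longleftrightarrow> i = k \<or> i = l"
proof -
  have "transpose k l \<in> star N i \<longleftrightarrow> (\<exists>j\<in>{1..N} - {i}. transpose i j = transpose k l)"
    unfolding star_def image_iff by metis
  also have "\<dots> \<longleftrightarrow> (\<exists>j\<in>{1..N} - {i}. i = k \<and> j = l \<or> i = l \<and> j = k)"
    using assms(4) transpose_eq_transpose_iff by (metis DiffD2 insertI1)
  also have "\<dots> \<longleftrightarrow> i = k \<or> i = l"
    using assms by blast
  finally show ?thesis .
qed

lemma two_cycles_cases:
  assumes "a \<in> two_cycles N"
  obtains k l where "a = transpose k l" "k \<in> {1..N}" "l \<in> {1..N}" "k \<noteq> l"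
  using assms by (auto simp: two_cycles_def)

text \<open>The complement of the star consists of the 2-cycles fixing \<open>i\<close>, and
  conjugation within the stabilizer of \<open>i\<close> stays there.\<close>

lemma conj_closed_compl_star:
  assumes i: "i \<in> {1..N}"
  shows "conj_closed (two_cycles N - star N i)"
  unfolding conj_closed_def
proof (intro ballI)
  fix c d assume c: "c \<in> two_cycles N - star N i" and d: "d \<in> two_cycles N - star N i"
  obtain k l where kl: "c = transpose k l" "k \<in> {1..N}" "l \<in> {1..N}" "k \<noteq> l"
    using c two_cycles_cases by blast
  obtain p q where pq: "d = transpose p q" "p \<in> {1..N}" "q \<in> {1..N}" "p \<noteq> q"
    using d two_cycles_cases by blast
  have "i \<noteq> k" "i \<noteq> l" "i \<noteq> p" "i \<noteq> q"
    using c d kl pq i transpose_in_star_iff by blast+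
  then have "i \<noteq> d k" "i \<noteq> d l"
    by (auto simp: pq(1) transpose_def)
  moreover have "d k \<in> {1..N}" "d l \<in> {1..N}" "d k \<noteq> d l"
    using kl pq by (auto simp: transpose_def)
  moreover have "conj_by d c = transpose (d k) (d l)"
    using kl(1) pq(1) by (simp add: conj_by_transpose)
  ultimately show "conj_by d c \<in> two_cycles N - star N i"
    using transpose_in_star_iff[OF i, of "d k" "d l"] by (auto simp: two_cycles_def)
qed

text \<open>A missing edge between \<open>v\<close> and \<open>w\<close> splits the vertices:
  \<open>A\<close> consists of \<open>v\<close> and its neighbours, hence omits \<open>w\<close>,
  and an edge of \<open>S\<close> leaving \<open>A\<close> would make its outer endpoint a neighbour
  of \<open>v\<close>.\<close>

lemma conj_closed_separation:
  assumes S: "S \<subseteq> two_cycles N" "conj_closed S" "S \<noteq> two_cycles N"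
  obtains A B where "A \<noteq> {}" "B \<noteq> {}" "A \<inter> B = {}" "A \<union> B = {1..N}"
    "\<And>a b. a \<in> A \<Longrightarrow> b \<in> B \<Longrightarrow> transpose a b \<in> two_cycles N - S"
proof -
  obtain t where "t \<in> two_cycles N" "t \<notin> S" using S by blast
  then obtain v w where vw: "transpose v w \<notin> S" "v \<in> {1..N}" "w \<in> {1..N}" "v \<noteq> w"
    using two_cycles_cases by metis
  \<comment> \<open>\<open>S\<close> is the edge set of a disjoint union of cliques; \<open>A\<close> is the clique of \<open>v\<close>.\<close>
  define A where "A = insert v {x \<in> {1..N}. transpose v x \<in> S}"
  show thesis
  proof
    show "A \<noteq> {}" "A \<inter> ({1..N} - A) = {}" "A \<union> ({1..N} - A) = {1..N}"
      using vw by (auto simp: A_def)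
    show "{1..N} - A \<noteq> {}" using vw by (auto simp: A_def)
    fix a b assume a: "a \<in> A" and b: "b \<in> {1..N} - A"
    have ab: "a \<in> {1..N}" "a \<noteq> b" "b \<noteq> v" using a b vw by (auto simp: A_def)
    have "transpose a b \<notin> S"
    proof
      assume abS: "transpose a b \<in> S"
      show False
      proof (cases "a = v")
        case True
        then show False using abS b by (auto simp: A_def)
      next
        case False
        then have "transpose v a \<in> S" using a by (auto simp: A_def)
        \<comment> \<open>Two edges with the common vertex \<open>a\<close> close up to a triangle:
          this conjugate is \<open>transpose v b\<close>.\<close>
        then have "conj_by (transpose v a) (transpose a b) \<in> S"
          using S(2) abS by (auto simp: conj_closed_def)
        then have "transpose v b \<in> S"
          using ab by (simp add: conj_by_transpose)
        then show False using b by (auto simp: A_def)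
      qed
    qed
    then show "transpose a b \<in> two_cycles N - S"
      using ab b by (auto simp: two_cycles_def)
  qed
qed

text \<open>The edges between \<open>A\<close> and \<open>B\<close> are distinct and all missing
  from \<open>S\<close>. If only \<open>N - 1\<close> edges are missing, there are no others, and
  one of the two parts is a single vertex.\<close>

lemma card_compl_conj_closed:
  assumes S: "S \<subseteq> two_cycles N" "conj_closed S" "S \<noteq> two_cycles N"
  shows "card (two_cycles N - S) \<ge> N - 1"
    and "card (two_cycles N - S) = N - 1 \<Longrightarrow> \<exists>i\<in>{1..N}. two_cycles N - S = star N i"
proof -
  obtain A B where AB: "A \<noteq> {}" "B \<noteq> {}" "A \<inter> B = {}" "A \<union> B = {1..N}"
    and cross: "\<And>a b. a \<in> A \<Longrightarrow> b \<in> B \<Longrightarrow> transpose a b \<in> two_cycles N - S"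
    using conj_closed_separation[OF S] by metis
  define E where "E = (\<lambda>(a, b). transpose a b) ` (A \<times> B)"
  have sub: "E \<subseteq> two_cycles N - S" using cross by (auto simp: E_def)
  have fin: "finite A" "finite B" using AB(4) by (metis finite_Un finite_atLeastAtMost)+
  have "inj_on (\<lambda>(a, b). transpose a b) (A \<times> B)"
  proof (rule inj_onI, clarify)
    fix a b a' b' assume *: "a \<in> A" "b \<in> B" "a' \<in> A" "b' \<in> B" "transpose a b = transpose a' b'"
    have "a \<noteq> b" "a' \<noteq> b'" "a \<noteq> b'" using * AB(3) by auto
    then show "a = a' \<and> b = b'" using *(5) transpose_eq_transpose_iff by metis
  qed
  then have cardE: "card E = card A * card B"
    by (simp add: E_def card_image card_cartesian_product)
  have N: "card A + card B = N"
    using card_Un_disjoint[OF fin AB(3)] AB(4) by simp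
  obtain p q where pq: "card A = Suc p" "card B = Suc q"
    using AB(1,2) fin by (metis card_eq_0_iff not0_implies_Suc)
  \<comment> \<open>Here \<open>card A = p + 1\<close>, \<open>card B = q + 1\<close> and
    \<open>N = p + q + 2\<close>, so \<open>p * q\<close> is the excess over the extremal
    case.\<close>
  have prod: "card A * card B = N - 1 + p * q"
    using N by (simp add: pq)
  have finC: "finite (two_cycles N - S)" by simp
  have le: "card E \<le> card (two_cycles N - S)"
    by (rule card_mono[OF finC sub])
  then show "card (two_cycles N - S) \<ge> N - 1"
    using cardE prod by linarith
  assume eq: "card (two_cycles N - S) = N - 1"
  \<comment> \<open>Squeezed from \<open>N - 1 + p * q = card E\<close> and
    \<open>card E \<le> N - 1\<close>.\<close>
  then have "p * q = 0" "card E = card (two_cycles N - S)"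
    using le cardE prod by linarith+
  then have EC: "E = two_cycles N - S"
    using card_subset_eq[OF finC sub] by blast
  from \<open>p * q = 0\<close> consider "card A = 1" | "card B = 1" using pq by auto
  then show "\<exists>i\<in>{1..N}. two_cycles N - S = star N i"
  proof cases
    case 1
    then obtain i where "A = {i}" by (auto simp: card_1_singleton_iff)
    moreover from this have "B = {1..N} - {i}" "i \<in> {1..N}" using AB by auto
    ultimately have "E = star N i" by (auto simp: E_def star_def)
    then show ?thesis using EC \<open>i \<in> {1..N}\<close> by blast
  next
    case 2
    then obtain i where "B = {i}" by (auto simp: card_1_singleton_iff)
    moreover from this have "A = {1..N} - {i}" "i \<in> {1..N}" using AB by auto
    ultimately have "E = star N i"
      by (auto simp: E_def star_def transpose_commute[of i])
    then show ?thesis using EC \<open>i \<in> {1..N}\<close> by blast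
  qed
qed

section \<open>The submaximal stratum\<close>

lemma minus_theta_i:
  assumes "i \<in> {1..N}"
  shows "- theta_i N i = (\<Sum>a\<in>two_cycles N - star N i. e a) - (theta N :: 'k::field tens)"
  using sum_diff[OF finite_two_cycles star_subset[OF assms], of "e :: _ \<Rightarrow> 'k tens"]
  by (simp add: theta_i_eq_sum_star theta_def)

lemma card_compl_star:
  "i \<in> {1..N} \<Longrightarrow> card (two_cycles N - star N i) = card (two_cycles N) - (N - 1)"
  using card_Diff_subset[OF finite_subset[OF star_subset finite_two_cycles] star_subset]
  by (simp add: card_star)

lemma flat01_submaximal:
  assumes "N \<ge> 2"
  shows "flat01 N (card (two_cycles N) - (N - 1)) = {- theta_i N i :: 'k::field tens | i. i \<in> {1..N}}"
proof -
  \<comment> \<open>Guards against truncation: the star at 1 shows that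
    \<open>card (two_cycles N) - (N - 1)\<close> is a true difference, so the size of the complement
    can be recovered from it.\<close>
  have C: "card (two_cycles N) \<ge> N - 1"
    using card_mono[OF finite_two_cycles star_subset, of 1 N] card_star[of 1 N] assms by simp
  have "{S. S \<subseteq> two_cycles N \<and> conj_closed S \<and> card S = card (two_cycles N) - (N - 1)} =
      (\<lambda>i. two_cycles N - star N i) ` {1..N}"
  proof (intro Set.set_eqI iffI)
    fix S assume "S \<in> {S. S \<subseteq> two_cycles N \<and> conj_closed S \<and> card S = card (two_cycles N) - (N - 1)}"
    then have S: "S \<subseteq> two_cycles N" "conj_closed S" "card S = card (two_cycles N) - (N - 1)"
      by auto
    have "card (two_cycles N - S) = N - 1"
      using card_Diff_subset[OF finite_subset[OF S(1) finite_two_cycles] S(1)] S(3) C by simp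
    \<comment> \<open>The complement has \<open>N - 1\<close> elements, at least one since
      \<open>N \<ge> 2\<close>.\<close>
    moreover have "S \<noteq> two_cycles N" using calculation assms by auto
    ultimately obtain i where "i \<in> {1..N}" "two_cycles N - S = star N i"
      using card_compl_conj_closed(2)[OF S(1,2)] by blast
    then show "S \<in> (\<lambda>i. two_cycles N - star N i) ` {1..N}"
      using S(1) by (metis double_diff image_eqI order_refl)
  qed (auto simp: conj_closed_compl_star card_compl_star simp del: atLeastAtMost_iff)
  then have "flat01 N (card (two_cycles N) - (N - 1)) =
      (\<lambda>i. (\<Sum>a\<in>two_cycles N - star N i. e a) - theta N :: 'k tens) ` {1..N}"
    by (simp add: flat01_eq image_image)
  also have "\<dots> = (\<lambda>i. - theta_i N i) ` {1..N}"
    by (rule image_cong) (simp_all only: minus_theta_i)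
  finally show ?thesis by blast
qed

text \<open>The connection \<open>- theta_i N 1\<close> attains the value. Any support of smaller
  size than the whole class is a proper conjugation-closed set, to which
  \<open>card_compl_conj_closed\<close> applies.\<close>

lemma submaximal_cardinality_eq:
  assumes "N \<ge> 2"
  shows "submaximal_cardinality TYPE('k::field) N = card (two_cycles N) - (N - 1)"
  unfolding submaximal_cardinality_def
proof (rule Max_eqI)
  let ?M = "{n. n < card (two_cycles N) \<and> stratum N n \<noteq> ({} :: 'k tens set)}"
  show "finite ?M" by simp
  have "card (two_cycles N) \<ge> N - 1"
    using card_mono[OF finite_two_cycles star_subset, of 1 N] card_star[of 1 N] assms by simp
  moreover have "- theta_i N 1 \<in> (flat01 N (card (two_cycles N) - (N - 1)) :: 'k tens set)"
    unfolding flat01_submaximal[OF assms] using assms by fastforce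
  ultimately show "card (two_cycles N) - (N - 1) \<in> ?M"
    using assms by (auto simp: stratum_def)
  fix m assume "m \<in> ?M"
  then obtain S where S: "S \<subseteq> two_cycles N" "conj_closed S" "card S = m" "m < card (two_cycles N)"
    by (auto simp: stratum_def flat01_eq)
  have "card (two_cycles N - S) = card (two_cycles N) - m"
    using card_Diff_subset[OF finite_subset[OF S(1) finite_two_cycles] S(1)] S(3) by simp
  moreover have "N - 1 \<le> card (two_cycles N - S)"
    using card_compl_conj_closed(1)[OF S(1,2)] S(3,4) by blast
  ultimately show "m \<le> card (two_cycles N) - (N - 1)"
    using S(4) by linarith
qed

section \<open>The representation on the quotient\<close>

lemma sub_rep_simps [simp]:
  "carrier (sub_rep S \<rho>) = S"
  "x \<oplus>\<^bsub>sub_rep S \<rho>\<^esub> y = x + y"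
  "\<zero>\<^bsub>sub_rep S \<rho>\<^esub> = 0"
  "c \<odot>\<^bsub>sub_rep S \<rho>\<^esub> x = pscale c x"
  "act (sub_rep S \<rho>) = \<rho>"
  by (simp_all add: sub_rep_def)

lemma linear_rep_sub_rep:
  fixes S :: "('a \<Rightarrow>\<^sub>0 'k::field) set"
  assumes "group G" "pm.subspace S"
    and "\<And>g x. g \<in> carrier G \<Longrightarrow> x \<in> S \<Longrightarrow> \<rho> g x \<in> S"
    and "\<And>g x y. g \<in> carrier G \<Longrightarrow> x \<in> S \<Longrightarrow> y \<in> S \<Longrightarrow> \<rho> g (x + y) = \<rho> g x + \<rho> g y"
    and "\<And>g c x. g \<in> carrier G \<Longrightarrow> x \<in> S \<Longrightarrow> \<rho> g (pscale c x) = pscale c (\<rho> g x)"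
    and "\<And>x. x \<in> S \<Longrightarrow> \<rho> \<one>\<^bsub>G\<^esub> x = x"
    and "\<And>g h x. g \<in> carrier G \<Longrightarrow> h \<in> carrier G \<Longrightarrow> x \<in> S \<Longrightarrow>
      \<rho> (g \<otimes>\<^bsub>G\<^esub> h) x = \<rho> g (\<rho> h x)"
  shows "linear_rep G (ring_of_type_algebra :: 'k ring) (sub_rep S \<rho>)"
proof -
  have "\<exists>y\<in>S. y + x = 0" if "x \<in> S" for x
    using that pm.subspace_neg[OF assms(2)] by (intro bexI[of _ "- x"]) auto
  then have "abelian_group (sub_rep S \<rho>)"
    using pm.subspace_add[OF assms(2)] pm.subspace_0[OF assms(2)]
    by (intro abelian_groupI) (simp_all add: add_ac)
  then have "Module.module (ring_of_type_algebra :: 'k ring) (sub_rep S \<rho>)"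
    using pm.subspace_scale[OF assms(2)]
    by (intro moduleI cring_from_type_algebra)
      (simp_all add: ring_of_type_algebra_def pm.scale_left_distrib pm.scale_right_distrib)
  then show ?thesis
    using assms field_from_type_algebra unfolding linear_rep_def by simp
qed

text \<open>Transport of structure: each axiom on \<open>V\<close> is the image under
  \<open>h\<close> of the axiom on \<open>W\<close>. Since \<open>rep_iso\<close> says nothing about
  zeros, the zero of \<open>V\<close> is prescribed separately. This spares verifying the axioms on
  cosets.\<close>

lemma linear_rep_rep_iso_image:
  fixes V :: "('g, 'k, 'v) rep" and W :: "('g, 'k, 'w) rep"
  assumes W: "linear_rep G K W" and h: "h \<in> rep_iso G K W V" and zero: "\<zero>\<^bsub>V\<^esub> = h \<zero>\<^bsub>W\<^esub>"
  shows "linear_rep G K V"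
proof -
  have G: "group G" and K: "Ring.field K" and M: "Module.module K W"
    using W by (simp_all add: linear_rep_def)
  interpret M: Module.module K W by (rule M)
  interpret G: group G by (rule G)
  have V: "carrier V = h ` carrier W"
    using h by (auto simp: rep_iso_def bij_betw_def)
  have add: "h x \<oplus>\<^bsub>V\<^esub> h y = h (x \<oplus>\<^bsub>W\<^esub> y)" if "x \<in> carrier W" "y \<in> carrier W" for x y
    using h that by (simp add: rep_iso_def)
  have smult: "c \<odot>\<^bsub>V\<^esub> h x = h (c \<odot>\<^bsub>W\<^esub> x)" if "c \<in> carrier K" "x \<in> carrier W" for c x
    using h that by (simp add: rep_iso_def)
  have act: "act V g (h x) = h (act W g x)" if "g \<in> carrier G" "x \<in> carrier W" for g x
    using h that by (simp add: rep_iso_def)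
  have "\<exists>y\<in>carrier W. h (y \<oplus>\<^bsub>W\<^esub> x) = h \<zero>\<^bsub>W\<^esub>" if "x \<in> carrier W" for x
    using that M.l_neg by (metis M.a_inv_closed)
  then have "abelian_group V"
    by (intro abelian_groupI) (auto simp: V zero add M.a_ac)
  then have "Module.module K V"
    by (intro moduleI M.R.is_cring)
      (auto simp: V add smult M.smult_l_distr M.smult_r_distr M.smult_assoc1)
  then show ?thesis
    using G K W G.one_closed G.m_closed unfolding linear_rep_def V by (auto simp: add smult act)
qed

text \<open>Used to turn around the map from the standard representation to the quotient. That
  \<open>W\<close> is a representation keeps the results of its operations in
  \<open>carrier W\<close>, where \<open>inv_into\<close> undoes \<open>h\<close>.\<close>

lemma rep_iso_inverse:
  fixes V :: "('g, 'k, 'v) rep" and W :: "('g, 'k, 'w) rep"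
  assumes W: "linear_rep G K W" and h: "h \<in> rep_iso G K W V"
  shows "inv_into (carrier W) h \<in> rep_iso G K V W"
proof -
  interpret M: Module.module K W
    using W by (simp add: linear_rep_def)
  have bij: "bij_betw h (carrier W) (carrier V)"
    using h by (simp add: rep_iso_def)
  then have inv: "inv_into (carrier W) h (h x) = x" if "x \<in> carrier W" for x
    using that by (simp add: bij_betw_def)
  have V: "carrier V = h ` carrier W"
    using bij by (simp add: bij_betw_def)
  show ?thesis
    unfolding rep_iso_def
  proof (intro CollectI conjI ballI)
    show "bij_betw (inv_into (carrier W) h) (carrier V) (carrier W)"
      by (rule bij_betw_inv_into[OF bij])
  next
    fix v w assume "v \<in> carrier V" "w \<in> carrier V"
    then obtain x y where "v = h x" "w = h y" "x \<in> carrier W" "y \<in> carrier W"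
      unfolding V by blast
    moreover from this have "v \<oplus>\<^bsub>V\<^esub> w = h (x \<oplus>\<^bsub>W\<^esub> y)"
      using h by (simp add: rep_iso_def)
    ultimately show "inv_into (carrier W) h (v \<oplus>\<^bsub>V\<^esub> w) =
        inv_into (carrier W) h v \<oplus>\<^bsub>W\<^esub> inv_into (carrier W) h w"
      by (simp add: inv)
  next
    fix c v assume c: "c \<in> carrier K" and "v \<in> carrier V"
    then obtain x where "v = h x" "x \<in> carrier W"
      unfolding V by blast
    moreover from this have "c \<odot>\<^bsub>V\<^esub> v = h (c \<odot>\<^bsub>W\<^esub> x)"
      using h c by (simp add: rep_iso_def)
    ultimately show "inv_into (carrier W) h (c \<odot>\<^bsub>V\<^esub> v) = c \<odot>\<^bsub>W\<^esub> inv_into (carrier W) h v"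
      using c by (simp add: inv)
  next
    fix g v assume g: "g \<in> carrier G" and "v \<in> carrier V"
    then obtain x where "v = h x" "x \<in> carrier W"
      unfolding V by blast
    moreover from this have "act V g v = h (act W g x)" "act W g x \<in> carrier W"
      using h g W by (simp_all add: rep_iso_def linear_rep_def)
    ultimately show "inv_into (carrier W) h (act V g v) = act W g (inv_into (carrier W) h v)"
      by (simp add: inv)
  qed
qed

section \<open>Cosets of a subspace and the operations on them\<close>

context
  fixes S W :: "('a \<Rightarrow>\<^sub>0 'k::field) set" and \<rho> :: "'g \<Rightarrow> ('a \<Rightarrow>\<^sub>0 'k) \<Rightarrow> ('a \<Rightarrow>\<^sub>0 'k)"
begin

definition quot_coset :: "('a \<Rightarrow>\<^sub>0 'k) \<Rightarrow> ('a \<Rightarrow>\<^sub>0 'k) set" where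
  "quot_coset x = W +>\<^bsub>sub_rep S \<rho>\<^esub> x"

lemma quot_coset_eq: "quot_coset x = (\<lambda>w. w + x) ` W"
  by (auto simp: quot_coset_def a_r_coset_def')

lemma carrier_quot_rep: "carrier (quot_rep (sub_rep S \<rho>) W) = quot_coset ` S"
  by (auto simp: quot_rep_def A_RCOSETS_def' quot_coset_def)

text \<open>By additivity, the translate of \<open>W\<close> by \<open>x\<close> goes to the
  translate of the image of \<open>W\<close>, which is \<open>W\<close> again.\<close>

lemma act_quot_rep:
  assumes "\<rho> g ` W = W" "\<And>w. w \<in> W \<Longrightarrow> \<rho> g (w + x) = \<rho> g w + \<rho> g x"
  shows "act (quot_rep (sub_rep S \<rho>) W) g (quot_coset x) = quot_coset (\<rho> g x)"
proof -
  have "\<rho> g ` quot_coset x = (\<lambda>w. w + \<rho> g x) ` (\<rho> g ` W)"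
    unfolding quot_coset_eq image_image using assms(2) by (intro image_cong) auto
  then show ?thesis
    by (simp add: quot_rep_def quot_coset_eq assms(1))
qed

context
  assumes W: "pm.subspace W"
begin

lemma mem_quot_coset_iff: "y \<in> quot_coset x \<longleftrightarrow> y - x \<in> W"
proof
  assume "y - x \<in> W"
  then show "y \<in> quot_coset x"
    unfolding quot_coset_eq by (rule image_eqI[rotated]) simp
qed (auto simp: quot_coset_eq)

lemma quot_coset_eq_iff: "quot_coset x = quot_coset y \<longleftrightarrow> x - y \<in> W"
proof
  assume "quot_coset x = quot_coset y"
  then show "x - y \<in> W"
    using mem_quot_coset_iff[of x x] mem_quot_coset_iff[of x y] pm.subspace_0[OF W] by simp
next
  assume xy: "x - y \<in> W"
  have "z - x \<in> W \<longleftrightarrow> z - y \<in> W" for z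
    using pm.subspace_add[OF W, of "z - x" "x - y"] pm.subspace_diff[OF W, of "z - y" "x - y"] xy
    by auto
  then show "quot_coset x = quot_coset y"
    by (auto simp: mem_quot_coset_iff)
qed

lemma quot_coset_0: "\<zero>\<^bsub>quot_rep (sub_rep S \<rho>) W\<^esub> = quot_coset 0"
  by (simp add: quot_rep_def quot_coset_eq)

lemma add_quot_rep:
  "quot_coset x \<oplus>\<^bsub>quot_rep (sub_rep S \<rho>) W\<^esub> quot_coset y = quot_coset (x + y)"
proof -
  have "quot_coset x \<oplus>\<^bsub>quot_rep (sub_rep S \<rho>) W\<^esub> quot_coset y =
      {a + b | a b. a \<in> quot_coset x \<and> b \<in> quot_coset y}"
    by (auto simp: quot_rep_def set_add_def')
  also have "\<dots> = quot_coset (x + y)"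
  proof (intro Set.set_eqI iffI)
    fix z assume "z \<in> {a + b | a b. a \<in> quot_coset x \<and> b \<in> quot_coset y}"
    then obtain a b where "z = a + b" "a - x \<in> W" "b - y \<in> W"
      by (auto simp: mem_quot_coset_iff)
    then show "z \<in> quot_coset (x + y)"
      using pm.subspace_add[OF W, of "a - x" "b - y"]
      by (simp add: mem_quot_coset_iff algebra_simps)
  next
    fix z assume "z \<in> quot_coset (x + y)"
    \<comment> \<open>The component of \<open>z\<close> in \<open>W\<close> is put entirely into the
      first summand.\<close>
    then have "z - y \<in> quot_coset x" "y \<in> quot_coset y" "z = (z - y) + y"
      using pm.subspace_0[OF W] by (simp_all add: mem_quot_coset_iff algebra_simps)
    then show "z \<in> {a + b | a b. a \<in> quot_coset x \<and> b \<in> quot_coset y}"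
      by blast
  qed
  finally show ?thesis .
qed

lemma smult_quot_rep:
  "c \<odot>\<^bsub>quot_rep (sub_rep S \<rho>) W\<^esub> quot_coset x = quot_coset (pscale c x)"
proof -
  have "c \<odot>\<^bsub>quot_rep (sub_rep S \<rho>) W\<^esub> quot_coset x = (\<Union>y\<in>quot_coset x. quot_coset (pscale c y))"
    by (simp add: quot_rep_def quot_coset_def)
  \<comment> \<open>All \<open>y\<close> in the coset give the same class, so the union over the
    nonempty coset collapses, also for \<open>c = 0\<close>.\<close>
  also have "\<dots> = (\<Union>y\<in>quot_coset x. quot_coset (pscale c x))"
  proof (rule SUP_cong)
    fix y assume "y \<in> quot_coset x"
    then show "quot_coset (pscale c y) = quot_coset (pscale c x)"
      using pm.subspace_scale[OF W, of "y - x" c]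
      by (simp add: mem_quot_coset_iff quot_coset_eq_iff pm.scale_right_diff_distrib)
  qed simp
  also have "\<dots> = quot_coset (pscale c x)"
    using pm.subspace_0[OF W] mem_quot_coset_iff[of x x] by auto
  finally show ?thesis .
qed

end

end

section \<open>The standard representation\<close>

definition sum_zero :: "nat \<Rightarrow> (nat \<Rightarrow>\<^sub>0 'k::field) set" where
  "sum_zero N = {x. Poly_Mapping.keys x \<subseteq> {1..N} \<and> (\<Sum>i\<in>{1..N}. Poly_Mapping.lookup x i) = 0}"

lemma standard_rep_eq: "standard_rep N = sub_rep (sum_zero N) (act_perm N)"
  by (simp add: standard_rep_def sum_zero_def)

lemma sum_zero_lookup: "x \<in> sum_zero N \<Longrightarrow> i \<notin> {1..N} \<Longrightarrow> Poly_Mapping.lookup x i = 0"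
  by (metis (no_types, lifting) in_keys_iff mem_Collect_eq subsetD sum_zero_def)

lemma sum_zero_iff:
  "x \<in> sum_zero N \<longleftrightarrow> (\<forall>i. i \<notin> {1..N} \<longrightarrow> Poly_Mapping.lookup x i = 0) \<and>
    (\<Sum>i\<in>{1..N}. Poly_Mapping.lookup x i) = 0"
  by (auto simp: sum_zero_def subset_iff in_keys_iff simp del: atLeastAtMost_iff)

lemma subspace_sum_zero: "pm.subspace (sum_zero N)"
  by (rule pm.subspaceI)
    (auto simp: sum_zero_iff lookup_add sum.distrib simp flip: sum_distrib_left)

text \<open>Moving basis vectors by \<open>g\<close> moves coordinates by its inverse. Positions
  outside \<open>{1..N}\<close> get 0 because \<open>act_perm\<close> sums over
  \<open>{1..N}\<close> only.\<close>

lemma lookup_act_perm: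
  assumes "g permutes {1..N}"
  shows "Poly_Mapping.lookup (act_perm N g x) i =
    (if i \<in> {1..N} then Poly_Mapping.lookup x (inv' g i) else 0)"
proof -
  have "Poly_Mapping.lookup (act_perm N g x) i =
      (\<Sum>j\<in>{1..N}. if j = inv' g i then Poly_Mapping.lookup x (inv' g i) else 0)"
    unfolding act_perm_def lookup_sum
    by (rule sum.cong) (auto simp: lookup_single when_def permutes_inverses[OF assms])
  also have "\<dots> = (if inv' g i \<in> {1..N} then Poly_Mapping.lookup x (inv' g i) else 0)"
    by simp
  also have "inv' g i \<in> {1..N} \<longleftrightarrow> i \<in> {1..N}"
    by (rule permutes_in_image[OF permutes_inv[OF assms]])
  finally show ?thesis .
qed

lemma act_perm_sum_zero:
  assumes g: "g permutes {1..N}" and x: "x \<in> sum_zero N"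
  shows "act_perm N g x \<in> sum_zero N"
  using x sum.permute[OF permutes_inv[OF g], of "Poly_Mapping.lookup x"]
  by (auto simp: sum_zero_iff lookup_act_perm[OF g] comp_def simp del: atLeastAtMost_iff cong: sum.cong)

lemma linear_rep_standard_rep:
  "linear_rep (sym_group N) (ring_of_type_algebra :: 'k::field ring)
    (standard_rep N :: (nat \<Rightarrow> nat, 'k, nat \<Rightarrow>\<^sub>0 'k) rep)"
  unfolding standard_rep_eq
proof (rule linear_rep_sub_rep)
  show "group (sym_group N)" by (rule sym_group_is_group)
  show "pm.subspace (sum_zero N :: (nat \<Rightarrow>\<^sub>0 'k) set)" by (rule subspace_sum_zero)
  fix g x y and c :: 'k
  assume "g \<in> carrier (sym_group N)"
  then have g: "g permutes {1..N}" by (simp add: sym_group_carrier)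
  show "act_perm N g (pscale c x) = pscale c (act_perm N g x)"
    by (rule poly_mapping_eqI) (simp add: lookup_act_perm[OF g])
  show "act_perm N g (x + y) = act_perm N g x + act_perm N g y"
    by (rule poly_mapping_eqI) (simp add: lookup_act_perm[OF g] lookup_add)
  show "act_perm N g x \<in> sum_zero N" if "x \<in> sum_zero N"
    using act_perm_sum_zero[OF g that] .
next
  fix x :: "nat \<Rightarrow>\<^sub>0 'k" assume "x \<in> sum_zero N"
  \<comment> \<open>The identity acts as truncation to \<open>{1..N}\<close> and fixes
    \<open>x\<close> because \<open>x\<close> is supported there.\<close>
  then show "act_perm N \<one>\<^bsub>sym_group N\<^esub> x = x"
    by (intro poly_mapping_eqI)
      (simp add: sym_group_one lookup_act_perm[OF permutes_id] sum_zero_lookup del: atLeastAtMost_iff)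
next
  fix g h :: "nat \<Rightarrow> nat" and x :: "nat \<Rightarrow>\<^sub>0 'k"
  assume "g \<in> carrier (sym_group N)" "h \<in> carrier (sym_group N)"
  then have g: "g permutes {1..N}" and h: "h permutes {1..N}"
    by (simp_all add: sym_group_carrier)
  have gh: "(g \<circ> h) permutes {1..N}"
    by (rule permutes_compose[OF h g])
  \<comment> \<open>Coordinates move by inverses, whose reversal of order makes this a left
    action.\<close>
  have "inv' (g \<circ> h) = inv' h \<circ> inv' g"
    by (rule o_inv_distrib) (use g h permutes_bij in blast)+
  then show "act_perm N (g \<otimes>\<^bsub>sym_group N\<^esub> h) x = act_perm N g (act_perm N h x)"
    by (intro poly_mapping_eqI)
      (simp add: sym_group_mult lookup_act_perm[OF g] lookup_act_perm[OF h] lookup_act_perm[OF gh]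
        permutes_in_image[OF permutes_inv[OF g]] del: atLeastAtMost_iff One_nat_def)
qed

lemma dim_sum_zero:
  assumes "N \<ge> 1"
  shows "pm.dim (sum_zero N :: (nat \<Rightarrow>\<^sub>0 'k::field) set) = N - 1"
proof (rule pm.dim_unique)
  \<comment> \<open>The basis consists of the differences between the \<open>i\<close>-th and the
    last basis vector, for \<open>i < N\<close>.\<close>
  define b where "b i = Poly_Mapping.single i 1 - Poly_Mapping.single N (1 :: 'k)" for i
  have lookup_b: "Poly_Mapping.lookup (b i) j = (if j = i then 1 else 0) - (if j = N then 1 else 0)" for i j
    by (auto simp: b_def lookup_minus lookup_single when_def)
  have lookup_sum_b: "Poly_Mapping.lookup (\<Sum>i\<in>{1..<N}. pscale (c i) (b i)) j =
      (if j \<in> {1..<N} then c j else 0) - (if j = N then (\<Sum>i\<in>{1..<N}. c i) else 0)" for c j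
    by (auto simp: lookup_sum lookup_b right_diff_distrib sum_subtractf if_distrib[of "(*) _"]
        cong: if_cong)
  have inj: "inj_on b {1..<N}"
  proof (rule inj_onI)
    fix i j assume "i \<in> {1..<N}" "j \<in> {1..<N}" "b i = b j"
    then show "i = j"
      using lookup_b[of i i] lookup_b[of j i] by (auto split: if_splits)
  qed
  have split: "{1..N} = insert N {1..<N}" using assms by auto
  show "b ` {1..<N} \<subseteq> sum_zero N"
    by (auto simp: sum_zero_iff lookup_b sum_subtractf)
  show "sum_zero N \<subseteq> pm.span (b ` {1..<N})"
  proof
    fix x :: "nat \<Rightarrow>\<^sub>0 'k" assume x: "x \<in> sum_zero N"
    have "x = (\<Sum>i\<in>{1..<N}. pscale (Poly_Mapping.lookup x i) (b i))"
    proof (rule poly_mapping_eqI)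
      fix j
      \<comment> \<open>The last coordinate is determined by the others, which serve as the
        coefficients.\<close>
      have "Poly_Mapping.lookup x N + (\<Sum>i\<in>{1..<N}. Poly_Mapping.lookup x i) = 0"
        using x unfolding sum_zero_iff split by simp
      then have "Poly_Mapping.lookup x N = - (\<Sum>i\<in>{1..<N}. Poly_Mapping.lookup x i)"
        by (simp add: eq_neg_iff_add_eq_0)
      then show "Poly_Mapping.lookup x j =
          Poly_Mapping.lookup (\<Sum>i\<in>{1..<N}. pscale (Poly_Mapping.lookup x i) (b i)) j"
        unfolding lookup_sum_b using sum_zero_lookup[OF x, of j] by auto
    qed
    also have "\<dots> \<in> pm.span (b ` {1..<N})"
      by (intro pm.span_sum pm.span_scale pm.span_base) auto
    finally show "x \<in> pm.span (b ` {1..<N})" .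
  qed
  show "pm.independent (b ` {1..<N})"
  proof (rule pm.independent_if_scalars_zero)
    fix c and x
    assume sum0: "(\<Sum>x\<in>b ` {1..<N}. pscale (c x) x) = 0" and "x \<in> b ` {1..<N}"
    then obtain j where j: "j \<in> {1..<N}" "x = b j" by blast
    \<comment> \<open>The scalars are indexed by vectors; injectivity of \<open>b\<close> reindexes
      the sum, and the coordinate at \<open>j < N\<close> isolates one scalar.\<close>
    have "(\<Sum>i\<in>{1..<N}. pscale (c (b i)) (b i)) = 0"
      using sum0 unfolding sum.reindex[OF inj] comp_def .
    then show "c x = 0"
      using lookup_sum_b[of "\<lambda>i. c (b i)" j] j by simp
  qed simp
  show "card (b ` {1..<N}) = N - 1"
    unfolding card_image[OF inj] by simp
qed

section \<open>Combinations of the \<open>theta_i\<close>\<close>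

definition theta_comb :: "nat \<Rightarrow> (nat \<Rightarrow> 'k::field) \<Rightarrow> 'k tens" where
  "theta_comb N c = (\<Sum>i\<in>{1..N}. pscale (c i) (theta_i N i))"

lemma theta_i_in_Lambda1: "i \<in> {1..N} \<Longrightarrow> theta_i N i \<in> Lambda1 N"
  by (simp only: theta_i_eq_sum_star sum_e_in_Lambda1 star_subset)

lemma theta_comb_in_Lambda1 [simp]: "theta_comb N c \<in> Lambda1 N"
  unfolding theta_comb_def by (intro Lambda1_closed) (rule theta_i_in_Lambda1)

lemma coeff1_theta_i:
  assumes "i \<in> {1..N}" "k \<in> {1..N}" "l \<in> {1..N}" "k \<noteq> l"
  shows "coeff1 (theta_i N i) (transpose k l) = (if i = k \<or> i = l then 1 else 0)"
proof -
  have "finite (star N i)" by (simp add: star_def)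
  then show ?thesis
    by (simp only: theta_i_eq_sum_star coeff1_sum_e transpose_in_star_iff[OF assms])
qed

text \<open>The edge between \<open>k\<close> and \<open>l\<close> lies in exactly two stars, those
  at \<open>k\<close> and \<open>l\<close>.\<close>

lemma coeff1_theta_comb:
  assumes "k \<in> {1..N}" "l \<in> {1..N}" "k \<noteq> l"
  shows "coeff1 (theta_comb N c) (transpose k l) = c k + c l"
proof -
  have "coeff1 (theta_comb N c) (transpose k l) =
      (\<Sum>i\<in>{1..N}. (if i = k then c k else 0) + (if i = l then c l else 0))"
    unfolding theta_comb_def coeff1_sum coeff1_simps
    by (rule sum.cong[OF refl]) (use assms in \<open>auto simp: coeff1_theta_i simp del: atLeastAtMost_iff\<close>)
  then show ?thesis
    using assms by (simp add: sum.distrib)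
qed

lemma eq_theta_combI:
  assumes "x \<in> Lambda1 N"
    "\<And>k l. k \<in> {1..N} \<Longrightarrow> l \<in> {1..N} \<Longrightarrow> k \<noteq> l \<Longrightarrow> coeff1 x (transpose k l) = c k + c l"
  shows "x = theta_comb N c"
proof (rule Lambda1_eqI[OF assms(1) theta_comb_in_Lambda1])
  fix a assume "a \<in> two_cycles N"
  then obtain k l where a: "a = transpose k l" and kl: "k \<in> {1..N}" "l \<in> {1..N}" "k \<noteq> l"
    using two_cycles_cases by blast
  show "coeff1 x a = coeff1 (theta_comb N c) a"
    unfolding a coeff1_theta_comb[OF kl] by (rule assms(2)[OF kl])
qed

lemma theta_comb_add: "theta_comb N c + theta_comb N d = theta_comb N (\<lambda>i. c i + d i)"
  by (simp add: theta_comb_def pm.scale_left_distrib sum.distrib)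

lemma theta_comb_diff: "theta_comb N c - theta_comb N d = theta_comb N (\<lambda>i. c i - d i)"
  by (simp add: theta_comb_def pm.scale_left_diff_distrib sum_subtractf)

lemma theta_comb_scale: "pscale r (theta_comb N c) = theta_comb N (\<lambda>i. r * c i)"
  by (simp add: theta_comb_def pm.scale_sum_right)

text \<open>Each 2-cycle lies in two stars, so the \<open>theta_i\<close> add up to twice
  \<open>theta\<close>. As \<open>theta_comb\<close> takes a plain function, a constant vector needs
  no cutoff at \<open>N\<close>.\<close>

lemma theta_eq_theta_comb: "theta N = theta_comb N (\<lambda>i. 1 / 2 :: 'k::field_char_0)"
proof (rule eq_theta_combI)
  fix k l assume "k \<in> {1..N}" "l \<in> {1..N}" "k \<noteq> l"
  then have "transpose k l \<in> two_cycles N"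
    unfolding two_cycles_def by blast
  then show "coeff1 (theta N) (transpose k l) = 1 / 2 + (1 / 2 :: 'k)"
    by (simp add: coeff1_theta)
qed simp

text \<open>Fails for \<open>N = 2\<close>, where \<open>theta_i 2 1 = theta_i 2 2\<close>.\<close>

lemma theta_comb_inj:
  fixes c d :: "nat \<Rightarrow> 'k::field_char_0"
  assumes "N \<ge> 3" "theta_comb N c = theta_comb N d" "i \<in> {1..N}"
  shows "c i = d i"
proof -
  have eq: "c k + c l = d k + d l" if "k \<in> {1..N}" "l \<in> {1..N}" "k \<noteq> l" for k l
    using assms(2) coeff1_theta_comb[OF that] by metis
  \<comment> \<open>Two further vertices from 1, 2, 3, so that \<open>i\<close>, \<open>j\<close>,
    \<open>k\<close> are distinct. The three edge sums of this triangle determine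
    \<open>2 * c i\<close>, and characteristic zero allows division by 2.\<close>
  define j k :: nat where "j = (if i = 1 then 2 else 1)" and "k = (if i = 3 then 2 else 3)"
  have j: "j \<in> {1..N}" "j \<noteq> i" and k: "k \<in> {1..N}" "k \<noteq> i" "k \<noteq> j"
    using assms(1) by (auto simp: j_def k_def)
  have "2 * c i = (c i + c j) + (c i + c k) - (c j + c k)" by (simp add: algebra_simps)
  also have "\<dots> = (d i + d j) + (d i + d k) - (d j + d k)"
    using eq[of i j] eq[of i k] eq[of j k] assms(3) j k by simp
  also have "\<dots> = 2 * d i" by (simp add: algebra_simps)
  finally show ?thesis by simp
qed

section \<open>The group action on these combinations\<close>

lemma coeff1_act_Lambda1:
  assumes g: "g permutes {1..N}" and kl: "k \<in> {1..N}" "l \<in> {1..N}" "k \<noteq> l"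
  shows "coeff1 (act_Lambda1 N g x) (transpose k l) = coeff1 x (transpose (inv' g k) (inv' g l))"
proof -
  let ?b = "transpose (inv' g k) (inv' g l)"
  have b: "?b \<in> two_cycles N"
    using kl permutes_in_image[OF permutes_inv[OF g]] permutes_inj[OF permutes_inv[OF g]]
    by (auto simp: two_cycles_def dest: injD)
  \<comment> \<open>Conjugation by \<open>g\<close> relabels endpoints, so exactly one 2-cycle
    contributes.\<close>
  have "conj_by g a = transpose k l \<longleftrightarrow> a = ?b" if a: "a \<in> two_cycles N" for a
  proof -
    obtain p q where pq: "a = transpose p q" "p \<noteq> q" using a two_cycles_cases by blast
    have "g p \<noteq> g q" "inv' g k \<noteq> inv' g l"
      using pq(2) kl(3) permutes_inj[OF g] permutes_inj[OF permutes_inv[OF g]] by (auto dest: injD)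
    then show ?thesis
      using pq kl(3) permutes_inverses[OF g]
      by (auto simp: conj_by_transpose permutes_bij[OF g] transpose_eq_transpose_iff)
  qed
  then have "coeff1 (act_Lambda1 N g x) (transpose k l) =
      (\<Sum>a\<in>two_cycles N. if a = ?b then coeff1 x ?b else 0)"
    unfolding act_Lambda1_def coeff1_sum coeff1_simps by (intro sum.cong) auto
  then show ?thesis using b by simp
qed

lemma act_Lambda1_in_Lambda1: "g permutes {1..N} \<Longrightarrow> act_Lambda1 N g x \<in> Lambda1 N"
  unfolding act_Lambda1_def by (intro Lambda1_closed) (simp add: conj_by_two_cycles)

text \<open>The \<open>theta_i\<close> are permuted like the basis vectors of the permutation
  representation; this is the equivariance of the later isomorphism.\<close>

lemma act_theta_comb:
  assumes g: "g permutes {1..N}"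
  shows "act_Lambda1 N g (theta_comb N c) = theta_comb N (\<lambda>i. c (inv' g i))"
proof (rule eq_theta_combI[OF act_Lambda1_in_Lambda1[OF g]])
  fix k l assume kl: "k \<in> {1..N}" "l \<in> {1..N}" "k \<noteq> l"
  have inv_kl: "inv' g k \<in> {1..N}" "inv' g l \<in> {1..N}" "inv' g k \<noteq> inv' g l"
    using kl permutes_in_image[OF permutes_inv[OF g]] permutes_inj[OF permutes_inv[OF g]]
    by (auto simp del: atLeastAtMost_iff dest: injD)
  show "coeff1 (act_Lambda1 N g (theta_comb N c)) (transpose k l) = c (inv' g k) + c (inv' g l)"
    by (simp only: coeff1_act_Lambda1[OF g kl] coeff1_theta_comb[OF inv_kl])
qed

lemma act_Lambda1_add: "act_Lambda1 N g (x + y) = act_Lambda1 N g x + act_Lambda1 N g y"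
  by (simp add: act_Lambda1_def pm.scale_left_distrib sum.distrib)

text \<open>Multiples of \<open>theta\<close> have constant coefficient vectors, which permutations
  leave fixed.\<close>

lemma act_Lambda1_span_theta:
  assumes "g permutes {1..N}"
  shows "act_Lambda1 N g ` pm.span {theta N :: 'k::field_char_0 tens} = pm.span {theta N}"
  unfolding pm.span_singleton image_image theta_eq_theta_comb theta_comb_scale
  by (simp add: act_theta_comb[OF assms])

text \<open>Summing \<open>theta - theta_i\<close> over all \<open>i\<close> gives
  \<open>theta\<close> times \<open>N - 2\<close>, which is nonzero for \<open>N \<ge> 3\<close> in
  characteristic zero. So \<open>theta\<close>, and then every \<open>theta_i\<close>, lies in the
  span.\<close>

lemma span_submaximal:
  fixes n N :: nat
  assumes N: "N \<ge> 3"
    and flat: "flat01 N n = {- theta_i N i :: 'k::field_char_0 tens | i. i \<in> {1..N}}"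
  shows theta_in_span_submaximal: "theta N \<in> pm.span (stratum N n :: 'k tens set)"
    and span_submaximal_eq: "pm.span (stratum N n :: 'k tens set) = range (theta_comb N)"
proof -
  have stratum: "stratum N n = (\<lambda>i. theta N - theta_i N i :: 'k tens) ` {1..N}"
    unfolding stratum_def flat setcompr_eq_image image_image by auto
  have "(\<Sum>i\<in>{1..N}. theta N - theta_i N i :: 'k tens) = pscale (of_nat N) (theta N) - theta_comb N (\<lambda>_. 1)"
  proof -
    have "(\<Sum>i\<in>A. theta N :: 'k tens) = pscale (of_nat (card A)) (theta N)" if "finite A" for A :: "nat set"
      using that by (induction rule: finite_induct) (simp_all add: pm.scale_left_distrib del: sum_constant)
    from this[of "{1..N}"] show ?thesis
      by (simp add: sum_subtractf theta_comb_def)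
  qed
  \<comment> \<open>The constant coefficient vector 1 represents twice \<open>theta\<close>.\<close>
  also have "\<dots> = pscale (of_nat N - 2) (theta N)"
    by (simp add: theta_eq_theta_comb theta_comb_scale theta_comb_diff algebra_simps diff_divide_distrib)
  finally have "pscale (of_nat N - 2) (theta N) \<in> pm.span (stratum N n :: 'k tens set)"
    unfolding stratum by (metis (no_types, lifting) pm.span_sum pm.span_base imageI)
  then have "pscale (1 / (of_nat N - 2)) (pscale (of_nat N - 2) (theta N)) \<in> pm.span (stratum N n :: 'k tens set)"
    by (rule pm.span_scale)
  moreover have "(of_nat N - 2 :: 'k) \<noteq> 0"
    using N of_nat_eq_iff[of N 2, where 'a='k] by simp
  ultimately show theta: "theta N \<in> pm.span (stratum N n :: 'k tens set)"
    by simp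
  show "pm.span (stratum N n :: 'k tens set) = range (theta_comb N)"
  proof (rule subset_antisym)
    have "theta N - theta_i N i \<in> range (theta_comb N :: _ \<Rightarrow> 'k tens)" if "i \<in> {1..N}" for i
    proof -
      have "theta_i N i = (theta_comb N (\<lambda>j. if j = i then 1 else 0) :: 'k tens)"
        using that by (simp add: theta_comb_def if_distrib[of "\<lambda>c. pscale c _"] cong: if_cong)
      then show ?thesis
        unfolding theta_eq_theta_comb by (simp only: theta_comb_diff rangeI)
    qed
    moreover have "pm.subspace (range (theta_comb N :: _ \<Rightarrow> 'k tens))"
    proof (rule pm.subspaceI)
      have "0 = (theta_comb N (\<lambda>_. 0) :: 'k tens)" by (simp add: theta_comb_def)
      then show "0 \<in> range (theta_comb N :: _ \<Rightarrow> 'k tens)" by blast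
    qed (auto simp: theta_comb_add theta_comb_scale)
    ultimately show "pm.span (stratum N n) \<subseteq> range (theta_comb N :: _ \<Rightarrow> 'k tens)"
      unfolding stratum by (intro pm.span_minimal) blast+
    have "theta_i N i \<in> pm.span (stratum N n :: 'k tens set)" if "i \<in> {1..N}" for i
    proof -
      have "theta N - theta_i N i \<in> pm.span (stratum N n :: 'k tens set)"
        unfolding stratum by (rule pm.span_base) (use that in blast)
      from pm.span_diff[OF theta this] show ?thesis by simp
    qed
    then show "range (theta_comb N :: _ \<Rightarrow> 'k tens) \<subseteq> pm.span (stratum N n)"
      unfolding theta_comb_def by (auto intro!: pm.span_sum pm.span_scale simp del: atLeastAtMost_iff)
  qed
qed

text \<open>Since \<open>N\<close> is invertible in the field, the constant vectors are a complement
  to the vectors of coordinate sum zero, so the latter represent each class modulo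
  \<open>theta\<close> exactly once.\<close>

lemma rep_iso_standard_rep:
  fixes n N :: nat
  assumes N: "N \<ge> 3"
    and flat: "flat01 N n = {- theta_i N i :: 'k::field_char_0 tens | i. i \<in> {1..N}}"
  obtains h where
    "h \<in> rep_iso (sym_group N) (ring_of_type_algebra :: 'k ring) (standard_rep N) (stratum_module N n)"
    "\<zero>\<^bsub>stratum_module N n\<^esub> = h 0"
proof
  define S where "S = pm.span (stratum N n :: 'k tens set)"
  define W where "W = pm.span {theta N :: 'k tens}"
  note S = span_submaximal_eq[OF N flat, folded S_def]
  have W: "pm.subspace W" by (simp add: W_def)
  \<comment> \<open>For \<open>N \<ge> 3\<close> the coefficients are determined by the combination,
    so membership in the line of \<open>theta\<close> can be read off from them.\<close>
  have mem_W: "theta_comb N c \<in> W \<longleftrightarrow> (\<exists>r. \<forall>i\<in>{1..N}. c i = r)" for c :: "nat \<Rightarrow> 'k"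
  proof
    assume "theta_comb N c \<in> W"
    then obtain r where "theta_comb N c = theta_comb N (\<lambda>_. r * (1 / 2))"
      by (auto simp: W_def pm.span_singleton theta_eq_theta_comb theta_comb_scale)
    then show "\<exists>r. \<forall>i\<in>{1..N}. c i = r"
      using theta_comb_inj[OF N] by blast
  next
    assume "\<exists>r. \<forall>i\<in>{1..N}. c i = r"
    then obtain r where "\<forall>i\<in>{1..N}. c i = r" by blast
    \<comment> \<open>The factor 2 compensates the coefficients \<open>1 / 2\<close> of
      \<open>theta\<close>.\<close>
    then have "theta_comb N c = pscale (2 * r) (theta N)"
      unfolding theta_eq_theta_comb theta_comb_scale by (simp add: theta_comb_def)
    then show "theta_comb N c \<in> W"
      by (simp add: W_def pm.span_scale pm.span_base)
  qed
  let ?co = "quot_coset S W (act_Lambda1 N)"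
  define h where "h v = ?co (theta_comb N (Poly_Mapping.lookup v))" for v
  have V: "stratum_module N n = quot_rep (sub_rep S (act_Lambda1 N)) W"
    by (simp add: stratum_module_def S_def W_def)
  have "inj_on h (sum_zero N)"
  proof (rule inj_onI)
    fix v w assume v: "v \<in> sum_zero N" and w: "w \<in> sum_zero N" and "h v = h w"
    then obtain r where r: "Poly_Mapping.lookup v i - Poly_Mapping.lookup w i = r" if "i \<in> {1..N}" for i
      unfolding h_def quot_coset_eq_iff[OF W] theta_comb_diff mem_W by blast
    \<comment> \<open>A constant vector of coordinate sum zero vanishes, because \<open>N\<close> is
      nonzero in the field.\<close>
    have "of_nat N * r = (\<Sum>i\<in>{1..N}. Poly_Mapping.lookup v i - Poly_Mapping.lookup w i)"
      using r by simp
    also have "\<dots> = 0"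
      using v w by (simp add: sum_subtractf sum_zero_iff)
    finally have "r = 0" using N by simp
    then show "v = w"
      using r sum_zero_lookup[OF v] sum_zero_lookup[OF w]
      by (intro poly_mapping_eqI) (metis eq_iff_diff_eq_0)
  qed
  moreover have "h ` sum_zero N = carrier (stratum_module N n)"
  proof (intro subset_antisym subsetI)
    fix A assume "A \<in> carrier (stratum_module N n :: (nat \<Rightarrow> nat, 'k, 'k tens set) rep)"
    then obtain c where A: "A = ?co (theta_comb N c)"
      unfolding V carrier_quot_rep S by blast
    \<comment> \<open>Subtracting the mean projects onto the vectors of coordinate sum zero and
      changes the combination only by a multiple of \<open>theta\<close>.\<close>
    define m where "m = (\<Sum>i\<in>{1..N}. c i) / of_nat N"
    define v where "v = (\<Sum>i\<in>{1..N}. Poly_Mapping.single i (c i - m))"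
    have lookup_v: "Poly_Mapping.lookup v i = (if i \<in> {1..N} then c i - m else 0)" for i
      by (simp add: v_def lookup_sum lookup_single when_def)
    have "v \<in> sum_zero N"
      using N by (simp add: sum_zero_iff lookup_v sum_subtractf m_def)
    moreover have "A = h v"
      unfolding A h_def quot_coset_eq_iff[OF W] theta_comb_diff mem_W by (simp add: lookup_v)
    ultimately show "A \<in> h ` sum_zero N" by blast
  qed (auto simp: V carrier_quot_rep S h_def)
  ultimately have "bij_betw h (sum_zero N) (carrier (stratum_module N n))"
    by (simp add: bij_betw_def)
  moreover have "h (act_perm N g v) = act (stratum_module N n) g (h v)"
    if "g permutes {1..N}" for g v
  proof -
    have "act_Lambda1 N g ` W = W"
      unfolding W_def by (rule act_Lambda1_span_theta[OF that])
    then have "act (stratum_module N n) g (h v) =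
        ?co (theta_comb N (\<lambda>i. Poly_Mapping.lookup v (inv' g i)))"
      unfolding V h_def
      by (simp add: act_quot_rep act_Lambda1_add act_theta_comb[OF that])
    \<comment> \<open>Agreement on \<open>{1..N}\<close> suffices, since \<open>theta_comb\<close>
      sums over that range.\<close>
    also have "theta_comb N (\<lambda>i. Poly_Mapping.lookup v (inv' g i)) =
        theta_comb N (Poly_Mapping.lookup (act_perm N g v))"
      unfolding theta_comb_def by (intro sum.cong) (simp_all add: lookup_act_perm[OF that])
    finally show ?thesis by (simp add: h_def)
  qed
  \<comment> \<open>The coordinate function is itself an argument of \<open>theta_comb\<close>, so
    scaling is needed as an equality of functions.\<close>
  moreover have "Poly_Mapping.lookup (pscale c v) = (\<lambda>i. c * Poly_Mapping.lookup v i)"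
    for c :: 'k and v :: "nat \<Rightarrow>\<^sub>0 'k"
    by (rule ext) simp
  ultimately show "h \<in> rep_iso (sym_group N) (ring_of_type_algebra :: 'k ring)
      (standard_rep N) (stratum_module N n)"
    unfolding rep_iso_def standard_rep_eq
    by (simp add: sym_group_carrier)
      (simp add: V h_def add_quot_rep[OF W] smult_quot_rep[OF W] theta_comb_add theta_comb_scale
        lookup_add[abs_def])
  have "theta_comb N (Poly_Mapping.lookup 0) = (0 :: 'k tens)"
    by (simp add: theta_comb_def)
  then show "\<zero>\<^bsub>stratum_module N n\<^esub> = h 0"
    unfolding V quot_coset_0[OF W] h_def by simp
qed

text \<open>For \<open>N = 2\<close> there is one 2-cycle and the submaximal stratum is
  \<open>{0}\<close>, whose span does not contain \<open>theta\<close>; hence the part on the module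
  assumes \<open>N \<ge> 3\<close>. The dimension is computed on the standard representation and
  carries over along the isomorphism.\<close>

theorem proposition4p6:
  fixes N n :: nat
  assumes "N \<ge> 2"
    and "n = submaximal_cardinality TYPE('k::field_char_0) N"
  shows "flat01 N n = {- theta_i N i :: 'k tens | i. i \<in> {1..N}} \<and>
    (N \<ge> 3 \<longrightarrow>
      (theta N :: 'k tens) \<in> pm.span (stratum N n) \<and>
      linear_rep (sym_group N) (ring_of_type_algebra :: 'k ring) (stratum_module N n) \<and>
      rep_iso (sym_group N) (ring_of_type_algebra :: 'k ring)
        (stratum_module N n) (standard_rep N) \<noteq> {} \<and>
      pm.dim (carrier (standard_rep N :: (nat \<Rightarrow> nat, 'k, nat \<Rightarrow>\<^sub>0 'k) rep)) = N - 1)"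
proof (intro conjI impI)
  show flat: "flat01 N n = {- theta_i N i :: 'k tens | i. i \<in> {1..N}}"
    unfolding assms(2) submaximal_cardinality_eq[OF assms(1)] by (rule flat01_submaximal[OF assms(1)])
  assume N: "N \<ge> 3"
  show "(theta N :: 'k tens) \<in> pm.span (stratum N n)"
    by (rule theta_in_span_submaximal[OF N flat])
  obtain h where h: "h \<in> rep_iso (sym_group N) (ring_of_type_algebra :: 'k ring)
      (standard_rep N) (stratum_module N n)" "\<zero>\<^bsub>stratum_module N n\<^esub> = h 0"
    using rep_iso_standard_rep[OF N flat] by blast
  show "linear_rep (sym_group N) (ring_of_type_algebra :: 'k ring) (stratum_module N n)"
    by (rule linear_rep_rep_iso_image[OF linear_rep_standard_rep h(1)])
      (simp add: standard_rep_eq h(2))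
  show "rep_iso (sym_group N) (ring_of_type_algebra :: 'k ring)
      (stratum_module N n) (standard_rep N) \<noteq> {}"
    using rep_iso_inverse[OF linear_rep_standard_rep h(1)] by blast
  show "pm.dim (carrier (standard_rep N :: (nat \<Rightarrow> nat, 'k, nat \<Rightarrow>\<^sub>0 'k) rep)) = N - 1"
    using dim_sum_zero[where 'k='k, of N] N by (simp add: standard_rep_eq)
qed

end
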